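(* Any non-transitive, locally forcing $h$-vertex tournament $H$ satisfies all of the following: (i) $\displaystyle\sum_{v\in V(H)}\big(d^+_H(v)-d^-_H(v)\big)^2\le h(h-1)$. (ii) For every ordering $\sigma$ of $H$, $\displaystyle\left||F_{\sigma,H}|-\tfrac12\tbinom h2\right|\le h^{3/2}\sqrt{\log h}$. (iii) For any disjoint subsets $U,W\subseteq V(H)$, $\displaystyle e(U,W)\le\tfrac12|U||W|+2h^{3/2}$.
   Context: A tournament $T=(V,E)$ is a finite vertex set $V=V(T)$ with edge set $E=E(T)\subset V\times V$ such that $(u,u)\notin E$ for all $u$, and exactly one of $(u,v),(v,u)$ lies in $E$ for all distinct $u,v\in V$. An $n$-vertex tournament is one with $|V(T)|=n$. $d^+_T(u)$ and $d^-_T(u)$ are the numbers of $v$ with $(u,v)\in E(T)$ and $(v,u)\in E(T)$, respectively. For $U,W\subseteq V(T)$, $e(U,W)$ is the number of edges $(u,w)\in E(T)$ with $u\in U$, $w\in W$. An ordering of $T$ is a bijection $\sigma:V(T)\to\{1,\dots,n\}$; $F_{\sigma,T}$ is the set of edges $(u,v)\in E(T)$ with $\sigma(u)<\sigma(v)$. $T$ is transitive if $F_{\sigma,T}=E(T)$ for some ordering $\sigma$. $\log$ is the natural logarithm. For tournaments $H,T$, a labelled embedding of $H$ into $T$ is a map $\phi:V(H)\to V(T)$ such that $(u,v)\in E(H)$ if and only if $(\phi(u),\phi(v))\in E(T)$. For $U\subset V(T)$, $N^*_T(H;U)$ is the number of labelled embeddings of $H$ into the subtournament $T[U]$ induced by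 $U$. An $h$-vertex tournament $H$ is locally forcing if for every $\varepsilon>0$ there are $\delta>0$ and $n_0\in\mathbb N$ such that every $n$-vertex tournament $T$ with $n\ge n_0$ and $\left|N^*_T(H;U)-2^{-\binom h2}|U|^h\right|\le\delta n^h$ for every $U\subset V(T)$ satisfies $\left||F_{\sigma,T}|-\frac12\binom n2\right|\le\varepsilon n^2$ for every ordering $\sigma$ of $T$. *)

theory Defs
  imports
    Complex_Main
    "HOL-Library.FuncSet"
    "Graph_Theory.Digraph_Component"
    "Graph_Theory.Pair_Digraph"
begin

locale tournament = pair_digraph T for T :: "'a pair_pre_digraph" +
  assumes exactly_one_arc:
    "\<lbrakk>u \<in> pverts T; v \<in> pverts T; u \<noteq> v\<rbrakk> \<Longrightarrow> ((u, v) \<in> parcs T) \<noteq> ((v, u) \<in> parcs T)"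

definition is_ordering :: "('a \<Rightarrow> nat) \<Rightarrow> 'a pair_pre_digraph \<Rightarrow> bool" where
  "is_ordering \<sigma> T \<longleftrightarrow> bij_betw \<sigma> (pverts T) {1..card (pverts T)}"

definition forward_arcs :: "('a \<Rightarrow> nat) \<Rightarrow> 'a pair_pre_digraph \<Rightarrow> ('a \<times> 'a) set" where
  "forward_arcs \<sigma> T = {(u, v) \<in> parcs T. \<sigma> u < \<sigma> v}"

definition transitive_tournament :: "'a pair_pre_digraph \<Rightarrow> bool" where
  "transitive_tournament T \<longleftrightarrow> (\<exists>\<sigma>. is_ordering \<sigma> T \<and> forward_arcs \<sigma> T = parcs T)"

definition arcs_between :: "'a pair_pre_digraph \<Rightarrow> 'a set \<Rightarrow> 'a set \<Rightarrow> nat" where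
  "arcs_between T U W = card {(u, w) \<in> parcs T. u \<in> U \<and> w \<in> W}"

text \<open>
  Embeddings are taken to be extensional functions, so that each map from
  \<open>verts H\<close> to \<open>verts G\<close> is counted exactly once. Injectivity is not required; it
  is automatic for tournaments, which have an arc between any two distinct vertices.
\<close>

definition labelled_embeddings ::
    "('a, 'b) pre_digraph \<Rightarrow> ('c, 'd) pre_digraph \<Rightarrow> ('a \<Rightarrow> 'c) set" where
  "labelled_embeddings H G =
     {\<phi> \<in> verts H \<rightarrow>\<^sub>E verts G. \<forall>u\<in>verts H. \<forall>v\<in>verts H.
        (u, v) \<in> arcs_ends H \<longleftrightarrow> (\<phi> u, \<phi> v) \<in> arcs_ends G}"

definition num_embeddings_in ::
    "'c pair_pre_digraph \<Rightarrow> 'a pair_pre_digraph \<Rightarrow> 'c set \<Rightarrow> nat" where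
  "num_embeddings_in T H U = card (labelled_embeddings (with_proj H) (with_proj T \<restriction> U))"

text \<open>
  The host tournament \<open>T\<close> ranges over tournaments with vertices in \<^typ>\<open>nat\<close>. This is no
  restriction: every finite tournament is isomorphic to one of these, and the condition
  is invariant under isomorphism.
\<close>

definition locally_forcing :: "'a pair_pre_digraph \<Rightarrow> bool" where
  "locally_forcing H \<longleftrightarrow>
     (let h = card (pverts H) in
      \<forall>\<epsilon>::real. \<epsilon> > 0 \<longrightarrow> (\<exists>\<delta>::real. \<delta> > 0 \<and> (\<exists>n\<^sub>0::nat.
        \<forall>(T :: nat pair_pre_digraph) n. tournament T \<and> card (pverts T) = n \<and> n \<ge> n\<^sub>0 \<and>
          (\<forall>U. U \<subseteq> pverts T \<longrightarrow>
            \<bar>real (num_embeddings_in T H U) - (1/2) ^ (h choose 2) * real (card U) ^ h\<bar>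
              \<le> \<delta> * real n ^ h)
        \<longrightarrow> (\<forall>\<sigma>. is_ordering \<sigma> T \<longrightarrow>
            \<bar>real (card (forward_arcs \<sigma> T)) - 1/2 * real (n choose 2)\<bar> \<le> \<epsilon> * real n ^ 2))))"

end

theory Submission
  imports Defs "HOL-Analysis.Convex" "HOL-Combinatorics.Permutations"
begin

text \<open>
  Let \<open>V\<close> and \<open>E\<close> be the vertices and arcs of the tournament \<open>H\<close>, \<open>h\<close> and \<open>m\<close> their numbers, and let
  \<open>S\<close> of an ordering be its number of forward arcs minus its number of backward arcs. For
  \<open>0 \<le> x \<le> 1\<close> let \<open>Z x\<close> be the sum over all \<open>h!\<close> orderings of the product over the arcs of
  \<open>1 + x\<close> for a forward and \<open>1 - x\<close> for a backward arc.

  The key point is that \<open>Z x \<le> h!\<close> for \<open>0 \<le> x < 1\<close> if \<open>H\<close> is locally forcing and not transitive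
  (\<open>sum_order_weight_le_fact\<close>). Indeed \<open>Z 1 = 0\<close>, as every ordering has a backward arc, so
  \<open>Z x > h!\<close> would give a \<open>y\<close> with \<open>0 < y < 1\<close> and \<open>Z y = h!\<close>. Consider a random-like tournament
  on \<open>{..<n}\<close> in which a pair \<open>i < j\<close> is oriented from \<open>i\<close> to \<open>j\<close> with density \<open>(1 + y) / 2\<close>. The
  bijections from \<open>V\<close> onto a given set of \<open>h\<close> vertices are embeddings with probabilities that add
  up to \<open>Z y / 2 ^ m = h! / 2 ^ m\<close>, just as in a tournament with all densities \<open>1/2\<close>. Hence every
  set \<open>U\<close> of vertices contains the right number of copies of \<open>H\<close>, while the natural order has too
  many forward arcs: \<open>H\<close> is not locally forcing.

  The random-like tournament is found without probability. A multi-affine function on a cube is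
  at some vertex at most its value at a given point; for a function that combines a count of
  signed 4-cycles with the number of forward arcs this yields both small signed 4-cycle counts
  and many forward arcs (\<open>exists_quasirandom_tournament\<close>). Few signed 4-cycles mean a small
  cut norm by the Cauchy-Schwarz inequality, and a small cut norm controls the embeddings into all \<open>U\<close>
  at once (\<open>counting_lemma\<close>).

  Combining an ordering with its reverse turns \<open>Z x \<le> h!\<close> into a bound on an exponential moment of a
  uniformly random ordering: the mean of \<open>cosh (x * S)\<close> is at most
  \<open>exp (m / 2 * (x\<^sup>2 + 2 * x ^ 4))\<close> (\<open>sum_cosh_surplus_le\<close>). The three claims follow.
  For small \<open>x\<close> the mean of \<open>S\<^sup>2\<close> is seen to be at most \<open>m\<close>; as this mean is a third
  of the sum of \<open>m\<close> and all squared degree differences, the first claim follows. For the other two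
  claims, a map \<open>c\<close> from \<open>V\<close> to \<open>k\<close> labels is refined to the orderings that sort by label. These have average
  \<open>S\<close> equal to \<open>surplus E c\<close>, and they make up a proportion of at least \<open>k ^ (-h)\<close> of all
  orderings, so that \<open>x * \<bar>surplus E c\<bar>\<close> is at most about \<open>h * ln k + m * x\<^sup>2\<close>
  (\<open>label_surplus_le\<close>). The second claim takes for \<open>c\<close> the ordering itself and \<open>x\<^sup>2 = ln h / h\<close>; the
  third one labels \<open>U\<close>, \<open>W\<close> and the rest, with \<open>x\<^sup>2 = 1 / h\<close>.
\<close>

section \<open>Signs and weights of orderings\<close>

definition order_sign :: "nat \<Rightarrow> nat \<Rightarrow> real" where
  "order_sign i j = (if i < j then 1 else if j < i then - 1 else 0)"

text \<open>
  Since arcs whose ends get equal values count 0, \<open>\<phi>\<close> may also be a labelling that is not injective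
  and only gives a weak order.
\<close>

definition surplus :: "('a \<times> 'a) set \<Rightarrow> ('a \<Rightarrow> nat) \<Rightarrow> real" where
  "surplus E \<phi> = (\<Sum>(u, v)\<in>E. order_sign (\<phi> u) (\<phi> v))"

definition order_weight :: "('a \<times> 'a) set \<Rightarrow> real \<Rightarrow> ('a \<Rightarrow> nat) \<Rightarrow> real" where
  "order_weight E x \<phi> = (\<Prod>(u, v)\<in>E. 1 + x * order_sign (\<phi> u) (\<phi> v))"

text \<open>
  The diagonal is 0 rather than \<open>1/2\<close> so that maps which identify the ends of an arc contribute
  nothing to counts of embeddings.
\<close>

definition biased_kernel :: "real \<Rightarrow> nat \<Rightarrow> nat \<Rightarrow> real" where
  "biased_kernel x i j = (if i = j then 0 else (1 + x * order_sign i j) / 2)"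

lemma order_sign_swap: "order_sign j i = - order_sign i j"
  by (simp add: order_sign_def)

lemma order_sign_self [simp]: "order_sign i i = 0"
  by (simp add: order_sign_def)

section \<open>Cut norm and counting of embeddings\<close>

text \<open>
  Up to a constant factor this is a bound on the cut norm. Weights with values between 0 and 1
  instead of sets are used because the counting lemma produces products of such weights.
\<close>

definition cut_bounded :: "nat \<Rightarrow> real \<Rightarrow> (nat \<Rightarrow> nat \<Rightarrow> real) \<Rightarrow> bool" where
  "cut_bounded n \<kappa> M \<longleftrightarrow>
     (\<forall>a b. (\<forall>i. 0 \<le> a i \<and> a i \<le> 1) \<longrightarrow> (\<forall>j. 0 \<le> b j \<and> b j \<le> 1) \<longrightarrow>
        \<bar>\<Sum>i<n. \<Sum>j<n. M i j * a i * b j\<bar> \<le> \<kappa>)"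

lemma sum_funcset_insert:
  assumes "u \<notin> V"
  shows "(\<Sum>\<phi>\<in>insert u V \<rightarrow>\<^sub>E U. F \<phi>) = (\<Sum>\<psi>\<in>V \<rightarrow>\<^sub>E U. \<Sum>i\<in>U. F (\<psi>(u := i)))"
proof -
  have "(\<Sum>\<phi>\<in>insert u V \<rightarrow>\<^sub>E U. F \<phi>) = (\<Sum>(i, \<psi>)\<in>U \<times> (V \<rightarrow>\<^sub>E U). F (\<psi>(u := i)))"
    unfolding PiE_insert_eq
    by (subst sum.reindex[OF inj_combinator[OF assms]]) (simp add: case_prod_unfold)
  also have "\<dots> = (\<Sum>i\<in>U. \<Sum>\<psi>\<in>V \<rightarrow>\<^sub>E U. F (\<psi>(u := i)))"
    by (simp add: sum.cartesian_product)
  also have "\<dots> = (\<Sum>\<psi>\<in>V \<rightarrow>\<^sub>E U. \<Sum>i\<in>U. F (\<psi>(u := i)))"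
    by (rule sum.swap)
  finally show ?thesis .
qed

lemma prod_between_0_1:
  fixes f :: "'b \<Rightarrow> real"
  assumes "\<And>e. e \<in> E \<Longrightarrow> 0 \<le> f e \<and> f e \<le> 1"
  shows "0 \<le> prod f E \<and> prod f E \<le> 1"
  using assms by (auto intro: prod_nonneg prod_le_1)

text \<open>
  Fix the images of all vertices but \<open>u\<close> and \<open>v\<close>. No arc of \<open>E\<close> joins \<open>u\<close> and \<open>v\<close>, so the product
  over \<open>E\<close> splits into a function of the image of \<open>u\<close> and one of the image of \<open>v\<close>, and the cut
  bound applies to the remaining double sum.
\<close>

lemma sum_arc_factor_bound:
  fixes M :: "nat \<Rightarrow> nat \<Rightarrow> real" and k :: "'a \<times> 'a \<Rightarrow> nat \<Rightarrow> nat \<Rightarrow> real"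
  assumes cut: "cut_bounded n \<kappa> M" and V: "finite V" "u \<in> V" "v \<in> V" "u \<noteq> v"
    and E: "finite E" "\<And>w z. (w, z) \<in> E \<Longrightarrow> w \<noteq> z \<and> {w, z} \<noteq> {u, v}"
    and k: "\<And>e i j. e \<in> E \<Longrightarrow> 0 \<le> k e i j \<and> k e i j \<le> 1"
    and U: "U \<subseteq> {..<n}"
  shows "\<bar>\<Sum>\<phi>\<in>V \<rightarrow>\<^sub>E U. M (\<phi> u) (\<phi> v) * (\<Prod>e\<in>E. k e (\<phi> (fst e)) (\<phi> (snd e)))\<bar>
           \<le> \<kappa> * real n ^ (card V - 2)"
proof -
  define V' where "V' = V - {u, v}"
  have V': "V = insert u (insert v V')" "v \<notin> V'" "u \<notin> insert v V'" "finite V'"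
    using V by (auto simp: V'_def)
  have cV': "card V' = card V - 2"
    using V' by (simp add: card_insert_if)
  have fU: "finite U" using U finite_subset by blast
  have cU: "card U \<le> n" using card_mono[OF _ U] by simp
  define Eu where "Eu = {e \<in> E. fst e = u \<or> snd e = u}"
  have split: "E = Eu \<union> (E - Eu)" "Eu \<inter> (E - Eu) = {}" "finite Eu" "finite (E - Eu)"
    using E by (auto simp: Eu_def)
  have inner: "\<bar>\<Sum>j\<in>U. \<Sum>i\<in>U. M i j * (\<Prod>e\<in>E. k e ((\<psi>(v := j, u := i)) (fst e)) ((\<psi>(v := j, u := i)) (snd e)))\<bar> \<le> \<kappa>"
    for \<psi>
  proof -
    define a where "a i = (\<Prod>e\<in>Eu. k e ((\<psi>(u := i)) (fst e)) ((\<psi>(u := i)) (snd e)))" for i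
    define b where "b j = (\<Prod>e\<in>E - Eu. k e ((\<psi>(v := j)) (fst e)) ((\<psi>(v := j)) (snd e)))" for j
    have a: "0 \<le> a i \<and> a i \<le> 1" for i
      unfolding a_def by (rule prod_between_0_1) (use k Eu_def in auto)
    have b: "0 \<le> b i \<and> b i \<le> 1" for i
      unfolding b_def by (rule prod_between_0_1) (use k Eu_def in auto)
    have prod: "(\<Prod>e\<in>E. k e ((\<psi>(v := j, u := i)) (fst e)) ((\<psi>(v := j, u := i)) (snd e))) = a i * b j" for i j
    proof -
      have "(\<Prod>e\<in>E. k e ((\<psi>(v := j, u := i)) (fst e)) ((\<psi>(v := j, u := i)) (snd e)))
         = (\<Prod>e\<in>Eu. k e ((\<psi>(v := j, u := i)) (fst e)) ((\<psi>(v := j, u := i)) (snd e)))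
          * (\<Prod>e\<in>E - Eu. k e ((\<psi>(v := j, u := i)) (fst e)) ((\<psi>(v := j, u := i)) (snd e)))"
        using split by (metis (no_types, lifting) prod.union_disjoint)
      also have "(\<Prod>e\<in>Eu. k e ((\<psi>(v := j, u := i)) (fst e)) ((\<psi>(v := j, u := i)) (snd e))) = a i"
        unfolding a_def
      proof (rule prod.cong[OF refl])
        fix e assume e: "e \<in> Eu"
        have "fst e \<noteq> v \<and> snd e \<noteq> v"
          using e E(2)[of "fst e" "snd e"] V(4) by (auto simp: Eu_def)
        then show "k e ((\<psi>(v := j, u := i)) (fst e)) ((\<psi>(v := j, u := i)) (snd e)) =
          k e ((\<psi>(u := i)) (fst e)) ((\<psi>(u := i)) (snd e))" by simp
      qed
      also have "(\<Prod>e\<in>E-Eu. k e ((\<psi>(v := j, u := i)) (fst e)) ((\<psi>(v := j, u := i)) (snd e))) = b j"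
        unfolding b_def by (rule prod.cong[OF refl]) (auto simp: Eu_def)
      finally show ?thesis .
    qed
    define a' where "a' i = (if i \<in> U then a i else 0)" for i
    define b' where "b' i = (if i \<in> U then b i else 0)" for i
    have "(\<Sum>j\<in>U. \<Sum>i\<in>U. M i j * (a i * b j)) = (\<Sum>i\<in>U. \<Sum>j\<in>U. M i j * a i * b j)"
      by (subst sum.swap) (simp add: mult.assoc)
    also have "\<dots> = (\<Sum>i<n. \<Sum>j<n. M i j * a' i * b' j)"
      unfolding a'_def b'_def
      by (intro sum.mono_neutral_cong_left) (use U in \<open>auto intro!: sum.mono_neutral_cong_left\<close>)
    finally show ?thesis
      using cut a b unfolding prod cut_bounded_def by (auto simp: a'_def b'_def)
  qed
  have "(\<Sum>\<phi>\<in>V \<rightarrow>\<^sub>E U. M (\<phi> u) (\<phi> v) * (\<Prod>e\<in>E. k e (\<phi> (fst e)) (\<phi> (snd e))))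
      = (\<Sum>\<psi>\<in>V' \<rightarrow>\<^sub>E U. \<Sum>j\<in>U. \<Sum>i\<in>U. M i j * (\<Prod>e\<in>E. k e ((\<psi>(v := j, u := i)) (fst e)) ((\<psi>(v := j, u := i)) (snd e))))"
    unfolding V'(1) sum_funcset_insert[OF V'(3)] sum_funcset_insert[OF V'(2)]
    using V(4) by simp
  also have "\<bar>\<dots>\<bar> \<le> (\<Sum>\<psi>\<in>V' \<rightarrow>\<^sub>E U. \<kappa>)"
    by (rule order_trans[OF sum_abs sum_mono[OF inner]])
  also have "\<dots> = \<kappa> * real (card U) ^ (card V - 2)"
    using V' cV' by (simp add: card_funcsetE)
  also have "\<dots> \<le> \<kappa> * real n ^ (card V - 2)"
  proof (rule mult_left_mono)
    show "real (card U) ^ (card V - 2) \<le> real n ^ (card V - 2)" using cU by (intro power_mono) auto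
    show "0 \<le> \<kappa>" using inner[of undefined] by linarith
  qed
  finally show ?thesis .
qed

text \<open>
  The factors are switched from \<open>g\<close> to \<open>f\<close> one arc at a time; each step leaves a factor \<open>f - g\<close>
  at one arc and factors between 0 and 1 at the others.
\<close>

lemma counting_lemma:
  fixes f g :: "nat \<Rightarrow> nat \<Rightarrow> real"
  assumes cut: "cut_bounded n \<kappa> (\<lambda>i j. f i j - g i j)"
    and V: "finite V" and E: "E \<subseteq> V \<times> V" "\<And>u v. (u, v) \<in> E \<Longrightarrow> u \<noteq> v \<and> (v, u) \<notin> E"
    and f: "\<And>i j. 0 \<le> f i j \<and> f i j \<le> 1" and g: "\<And>i j. 0 \<le> g i j \<and> g i j \<le> 1"
    and U: "U \<subseteq> {..<n}"
  shows "\<bar>(\<Sum>\<phi>\<in>V \<rightarrow>\<^sub>E U. \<Prod>(u, v)\<in>E. f (\<phi> u) (\<phi> v)) - (\<Sum>\<phi>\<in>V \<rightarrow>\<^sub>E U. \<Prod>(u, v)\<in>E. g (\<phi> u) (\<phi> v))\<bar>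
     \<le> real (card E) * (\<kappa> * real n ^ (card V - 2))"
proof -
  have finE: "finite E" using E(1) V by (meson finite_SigmaI finite_subset)
  \<comment> \<open>the arcs in \<open>A\<close> have already been switched from \<open>g\<close> to \<open>f\<close>\<close>
  define hyb where "hyb A e i j = (if e \<in> A then f i j else g i j)" for A :: "('a \<times> 'a) set" and e i j
  define S where "S A = (\<Sum>\<phi>\<in>V \<rightarrow>\<^sub>E U. \<Prod>e\<in>E. hyb A e (\<phi> (fst e)) (\<phi> (snd e)))" for A
  have "finite A \<Longrightarrow> A \<subseteq> E \<Longrightarrow> \<bar>S A - S {}\<bar> \<le> real (card A) * (\<kappa> * real n ^ (card V - 2))" for A
  proof (induction A rule: finite_induct)
    case empty
    then show ?case by simp
  next
    case (insert e A)
    obtain u v where e: "e = (u, v)" by fastforce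
    have uv: "u \<in> V" "v \<in> V" "u \<noteq> v" "(u, v) \<in> E"
      using insert.prems E e by auto
    have step: "(\<Prod>e'\<in>E. hyb (insert e A) e' (\<phi> (fst e')) (\<phi> (snd e'))) - (\<Prod>e'\<in>E. hyb A e' (\<phi> (fst e')) (\<phi> (snd e')))
       = (f (\<phi> u) (\<phi> v) - g (\<phi> u) (\<phi> v)) * (\<Prod>e'\<in>E - {e}. hyb A e' (\<phi> (fst e')) (\<phi> (snd e')))" for \<phi>
    proof -
      have *: "(\<Prod>e'\<in>E. F e') = F e * (\<Prod>e'\<in>E - {e}. F e')" for F :: "_ \<Rightarrow> real"
        using uv(4) e finE by (simp add: prod.remove)
      have "(\<Prod>e'\<in>E - {e}. hyb (insert e A) e' (\<phi> (fst e')) (\<phi> (snd e'))) = (\<Prod>e'\<in>E - {e}. hyb A e' (\<phi> (fst e')) (\<phi> (snd e')))"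
        by (rule prod.cong) (auto simp: hyb_def)
      then show ?thesis
        unfolding * using insert.hyps e by (simp add: hyb_def algebra_simps)
    qed
    have "S (insert e A) - S A = (\<Sum>\<phi>\<in>V \<rightarrow>\<^sub>E U. (f (\<phi> u) (\<phi> v) - g (\<phi> u) (\<phi> v)) * (\<Prod>e'\<in>E - {e}. hyb A e' (\<phi> (fst e')) (\<phi> (snd e'))))"
      unfolding S_def sum_subtractf[symmetric] step ..
    moreover have "\<bar>\<dots>\<bar> \<le> \<kappa> * real n ^ (card V - 2)"
    proof (rule sum_arc_factor_bound[OF cut V uv(1-3) _ _ _ U])
      show "finite (E - {e})" using finE by simp
      show "w \<noteq> z \<and> {w, z} \<noteq> {u, v}" if "(w, z) \<in> E - {e}" for w z
        using that E(2) uv e by (auto simp: doubleton_eq_iff)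
      show "0 \<le> hyb A e' i j \<and> hyb A e' i j \<le> 1" for e' i j
        using f g by (auto simp: hyb_def)
    qed
    ultimately have "\<bar>S (insert e A) - S A\<bar> \<le> \<kappa> * real n ^ (card V - 2)" by simp
    then show ?case using insert by (simp add: algebra_simps)
  qed
  from this[OF finE order_refl] show ?thesis
    unfolding S_def by (simp add: hyb_def case_prod_unfold)
qed

text \<open>
  The hypothesis bounds the sum of \<open>M i j * M i k * M i' j * M i' k\<close> over all closed 4-walks. Two
  applications of the Cauchy-Schwarz inequality remove first the weights \<open>a\<close> and then the weights \<open>b\<close>.
\<close>

lemma cut_bounded_if_few_4_cycles:
  fixes M :: "nat \<Rightarrow> nat \<Rightarrow> real"
  assumes R: "(\<Sum>j<n. \<Sum>k<n. (\<Sum>i<n. M i j * M i k)\<^sup>2) \<le> r" and \<kappa>: "real n ^ 4 * r \<le> \<kappa> ^ 4" "0 \<le> \<kappa>"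
  shows "cut_bounded n \<kappa> M"
  unfolding cut_bounded_def
proof (intro allI impI)
  fix a b :: "nat \<Rightarrow> real"
  assume a: "\<forall>i. 0 \<le> a i \<and> a i \<le> 1" and b: "\<forall>j. 0 \<le> b j \<and> b j \<le> 1"
  define K where "K j k = (\<Sum>i<n. M i j * M i k)" for j k
  define s where "s = (\<Sum>i<n. \<Sum>j<n. M i j * a i * b j)"
  have "s = (\<Sum>i<n. a i * (\<Sum>j<n. M i j * b j))"
    unfolding s_def by (simp add: sum_distrib_left mult_ac)
  then have "s\<^sup>2 \<le> (\<Sum>i<n. (a i)\<^sup>2) * (\<Sum>i<n. (\<Sum>j<n. M i j * b j)\<^sup>2)"
    by (simp add: Cauchy_Schwarz_ineq_sum)
  also have "\<dots> \<le> real n * (\<Sum>i<n. (\<Sum>j<n. M i j * b j)\<^sup>2)"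
  proof (rule mult_right_mono)
    show "(\<Sum>i<n. (a i)\<^sup>2) \<le> real n"
      using sum_bounded_above[of "{..<n}" "\<lambda>i. (a i)\<^sup>2" 1] a by (simp add: power_le_one)
  qed (simp add: sum_nonneg)
  also have "(\<Sum>i<n. (\<Sum>j<n. M i j * b j)\<^sup>2) = (\<Sum>i<n. \<Sum>j<n. \<Sum>k<n. b j * b k * (M i j * M i k))"
    by (simp add: power2_eq_square sum_product mult_ac)
  also have "\<dots> = (\<Sum>j<n. \<Sum>i<n. \<Sum>k<n. b j * b k * (M i j * M i k))"
    by (rule sum.swap)
  also have "\<dots> = (\<Sum>j<n. \<Sum>k<n. \<Sum>i<n. b j * b k * (M i j * M i k))"
    by (rule sum.cong[OF refl sum.swap])
  also have "\<dots> = (\<Sum>j<n. \<Sum>k<n. b j * b k * K j k)"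
    by (simp add: K_def sum_distrib_left)
  also have "\<dots> \<le> (\<Sum>j<n. \<Sum>k<n. \<bar>K j k\<bar>)"
  proof (intro sum_mono)
    fix j k
    have "0 \<le> b j * b k" "b j * b k \<le> 1" using b by (auto intro: mult_le_one)
    then have "b j * b k * \<bar>K j k\<bar> \<le> \<bar>K j k\<bar>" by (simp add: mult_left_le_one_le)
    moreover have "b j * b k * K j k \<le> b j * b k * \<bar>K j k\<bar>"
      using \<open>0 \<le> b j * b k\<close> by (intro mult_left_mono) auto
    ultimately show "b j * b k * K j k \<le> \<bar>K j k\<bar>" by linarith
  qed
  finally have s2: "s\<^sup>2 \<le> real n * (\<Sum>j<n. \<Sum>k<n. \<bar>K j k\<bar>)"
    by (simp add: mult_left_mono)
  have "(\<Sum>j<n. \<Sum>k<n. \<bar>K j k\<bar>)\<^sup>2 = (\<Sum>p\<in>{..<n} \<times> {..<n}. \<bar>case_prod K p\<bar>)\<^sup>2"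
    unfolding sum.cartesian_product by (simp only: case_prod_unfold)
  also have "\<dots> \<le> (\<Sum>p\<in>{..<n} \<times> {..<n}. (\<bar>case_prod K p\<bar>)\<^sup>2) * real (card ({..<n} \<times> {..<n}))"
    by (rule sum_squared_le_sum_of_squares)
  also have "\<dots> = real n ^ 2 * (\<Sum>j<n. \<Sum>k<n. (K j k)\<^sup>2)"
    by (simp add: sum.cartesian_product case_prod_unfold power2_eq_square)
  also have "\<dots> \<le> real n ^ 2 * r"
    using R unfolding K_def by (intro mult_left_mono) auto
  finally have K2: "(\<Sum>j<n. \<Sum>k<n. \<bar>K j k\<bar>)\<^sup>2 \<le> real n ^ 2 * r" .
  have "\<bar>s\<bar> ^ 4 = (s\<^sup>2)\<^sup>2" by (simp add: power_even_abs)
  also have "\<dots> \<le> (real n * (\<Sum>j<n. \<Sum>k<n. \<bar>K j k\<bar>))\<^sup>2"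
    by (rule power_mono[OF s2]) simp
  also have "\<dots> = real n ^ 2 * (\<Sum>j<n. \<Sum>k<n. \<bar>K j k\<bar>)\<^sup>2" by (simp add: power_mult_distrib)
  also have "\<dots> \<le> real n ^ 2 * (real n ^ 2 * r)" by (intro mult_left_mono K2) auto
  also have "\<dots> = real n ^ 4 * r" by (simp add: power_add[symmetric] flip: mult.assoc)
  also have "\<dots> \<le> \<kappa> ^ 4" by (rule \<kappa>)
  finally show "\<bar>s\<bar> \<le> \<kappa>" using \<kappa>(2) power_mono_iff[of "\<bar>s\<bar>" \<kappa> 4] by simp
qed

section \<open>Rounding of multi-affine functions\<close>

text \<open>
  Changing one coordinate from \<open>p\<close> to 0 or 1 replaces a weighted mean of two values by the smaller
  one. Hence the coordinates can be rounded one after the other.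
\<close>

lemma exists_vertex_le_multiaffine:
  fixes \<Psi> :: "('b \<Rightarrow> real) \<Rightarrow> real"
  assumes P: "finite P" and p: "0 \<le> p" "p \<le> 1"
    and affine: "\<And>t e. e \<in> P \<Longrightarrow> \<Psi> (t(e := p)) = p * \<Psi> (t(e := 1)) + (1 - p) * \<Psi> (t(e := 0))"
  shows "\<exists>A\<subseteq>P. \<Psi> (\<lambda>e. of_bool (e \<in> A)) \<le> \<Psi> (\<lambda>e. if e \<in> P then p else 0)"
proof -
  have round: "\<exists>t'. (\<forall>e\<in>P'. t' e = 0 \<or> t' e = 1) \<and> (\<forall>e. e \<notin> P' \<longrightarrow> t' e = t e) \<and> \<Psi> t' \<le> \<Psi> t"
    if "P' \<subseteq> P" "\<And>e. e \<in> P' \<Longrightarrow> t e = p" for P' t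
    using finite_subset[OF that(1) P] that
  proof (induction P' arbitrary: t rule: finite_induct)
    case empty
    then show ?case by auto
  next
    case (insert e P')
    have te: "t(e := p) = t" using insert.prems by auto
    have "\<exists>b::real. (b = 0 \<or> b = 1) \<and> \<Psi> (t(e := b)) \<le> \<Psi> t"
    proof (rule ccontr)
      assume "\<not> ?thesis"
      then have "\<Psi> t < \<Psi> (t(e := 0))" "\<Psi> t < \<Psi> (t(e := 1))" by (auto simp: not_le)
      moreover have "\<Psi> t = p * \<Psi> (t(e := 1)) + (1 - p) * \<Psi> (t(e := 0))"
        using affine[of e t] insert.prems te by simp
      ultimately show False
        using p convex_bound_lt[of "- \<Psi> (t(e := 1))" "- \<Psi> t" "- \<Psi> (t(e := 0))" p "1 - p"] by simp
    qed
    then obtain b :: real where b: "b = 0 \<or> b = 1" "\<Psi> (t(e := b)) \<le> \<Psi> t" by blast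
    have "\<exists>t'. (\<forall>x\<in>P'. t' x = 0 \<or> t' x = 1) \<and> (\<forall>x. x \<notin> P' \<longrightarrow> t' x = (t(e := b)) x) \<and> \<Psi> t' \<le> \<Psi> (t(e := b))"
      by (rule insert.IH) (use insert in auto)
    then obtain t' where t': "\<forall>x\<in>P'. t' x = 0 \<or> t' x = 1" "\<forall>x. x \<notin> P' \<longrightarrow> t' x = (t(e := b)) x"
      "\<Psi> t' \<le> \<Psi> (t(e := b))" by blast
    have "t' e = b" using t'(2) insert.hyps by simp
    then show ?case
      using t' b by (intro exI[of _ t']) auto
  qed
  obtain t' where t': "\<forall>e\<in>P. t' e = 0 \<or> t' e = 1" "\<forall>e. e \<notin> P \<longrightarrow> t' e = 0"
      "\<Psi> t' \<le> \<Psi> (\<lambda>e. if e \<in> P then p else 0)"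
    using round[of P "\<lambda>e. if e \<in> P then p else 0"] by auto
  have "t' = (\<lambda>e. of_bool (e \<in> {e \<in> P. t' e = 1}))"
    using t' by (auto simp: fun_eq_iff)
  with t'(3) show ?thesis by (intro exI[of _ "{e \<in> P. t' e = 1}"]) auto
qed

text \<open>
  The vector \<open>t\<close> has one coordinate for each pair \<open>i < j\<close>, the density of the orientation from \<open>i\<close>
  to \<open>j\<close>; \<open>deviation p t\<close> is the antisymmetric matrix of the differences between the densities given
  by \<open>t\<close> and those of the kernel with constant density \<open>p\<close> from smaller to larger numbers.
\<close>

definition deviation :: "real \<Rightarrow> (nat \<times> nat \<Rightarrow> real) \<Rightarrow> nat \<Rightarrow> nat \<Rightarrow> real" where
  "deviation p t i j = order_sign i j * (t (min i j, max i j) - p)"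

lemma min_max_eq_iff:
  fixes i j a b :: "'b :: linorder"
  shows "min i j = min a b \<and> max i j = max a b \<longleftrightarrow> {i, j} = {a, b}"
  by (cases "i \<le> j"; cases "a \<le> b") (auto simp: min_def max_def doubleton_eq_iff)

text \<open>
  The four entries of a proper 4-cycle belong to four different pairs, so each coordinate occurs in at
  most one factor.
\<close>

lemma deviation_4_cycle_affine:
  fixes p :: real
  assumes "i \<noteq> i'" "j \<noteq> k"
  defines "G \<equiv> \<lambda>t. deviation p t i j * deviation p t i k * (deviation p t i' j * deviation p t i' k)"
  shows "G (t(e := p)) = p * G (t(e := 1)) + (1 - p) * G (t(e := 0))"
proof (cases "i = j \<or> i = k \<or> i' = j \<or> i' = k")
  case True
  moreover have "deviation p t l l = 0" for t l by (simp add: deviation_def order_sign_def)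
  ultimately show ?thesis unfolding G_def by (elim disjE) simp_all
next
  case False
  define e1 e2 e3 e4 where es: "e1 = (min i j, max i j)" "e2 = (min i k, max i k)"
     "e3 = (min i' j, max i' j)" "e4 = (min i' k, max i' k)"
  have d: "distinct [e1, e2, e3, e4]"
    using False assms(1,2) by (simp add: es min_max_eq_iff doubleton_eq_iff)
  define s where "s = order_sign i j * order_sign i k * (order_sign i' j * order_sign i' k)"
  have G: "G t = s * ((t e1 - p) * (t e2 - p) * ((t e3 - p) * (t e4 - p)))" for t
    by (simp add: G_def s_def deviation_def es)
  have d': "e1 \<noteq> e2" "e1 \<noteq> e3" "e1 \<noteq> e4" "e2 \<noteq> e3" "e2 \<noteq> e4" "e3 \<noteq> e4" using d by auto
  note ne = d' d'[symmetric]
  define r where "r x = t x - p" for x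
  consider (once) B where "\<And>y. G (t(e := y)) = (y - p) * B" | (never) "\<And>y. G (t(e := y)) = G t"
  proof -
    consider "e = e1" | "e = e2" | "e = e3" | "e = e4" | "e \<noteq> e1" "e \<noteq> e2" "e \<noteq> e3" "e \<noteq> e4" by blast
    then show thesis
    proof cases
      case 1
      show ?thesis by (rule once[of "s * (r e2 * (r e3 * r e4))"]) (use 1 ne in \<open>simp add: G r_def\<close>)
    next
      case 2
      show ?thesis by (rule once[of "s * (r e1 * (r e3 * r e4))"]) (use 2 ne in \<open>simp add: G r_def\<close>)
    next
      case 3
      show ?thesis by (rule once[of "s * (r e1 * r e2 * r e4)"]) (use 3 ne in \<open>simp add: G r_def\<close>)
    next
      case 4
      show ?thesis by (rule once[of "s * (r e1 * r e2 * r e3)"]) (use 4 ne in \<open>simp add: G r_def\<close>)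
    next
      case 5
      show ?thesis by (rule never) (use 5 in \<open>simp add: G\<close>)
    qed
  qed
  then show ?thesis
  proof cases
    case once
    show ?thesis unfolding once by (simp add: algebra_simps)
  next
    case never
    show ?thesis unfolding never by (simp add: algebra_simps)
  qed
qed

text \<open>
  Rounding is applied to the sum over the proper 4-cycles minus \<open>c\<close> times the excess of forward
  pairs, which vanishes when all densities are \<open>p\<close>. The degenerate 4-walks contribute at most
  \<open>2 * n ^ 3\<close>. An upper bound for the 4-cycle sum then comes from the trivial bound on the excess,
  and a lower bound for the excess from the fact that the sum of all closed 4-walks is not negative.
\<close>

lemma exists_quasirandom_deviation:
  fixes p c :: real and n :: nat
  assumes p: "0 \<le> p" "p \<le> 1" and c: "c > 0"
  defines "P \<equiv> {(i, j). i < j \<and> j < n}"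
  shows "\<exists>A\<subseteq>P. (\<Sum>j<n. \<Sum>k<n. (\<Sum>i<n. deviation p (\<lambda>e. of_bool (e \<in> A)) i j * deviation p (\<lambda>e. of_bool (e \<in> A)) i k)\<^sup>2)
             \<le> 2 * real n ^ 3 + c * real n ^ 2
         \<and> real (card A) \<ge> p * real (card P) - 2 * real n ^ 3 / c"
proof -
  have P: "finite P" unfolding P_def by (rule finite_subset[of _ "{..<n} \<times> {..<n}"]) auto
  have cP: "real (card P) \<le> real n ^ 2"
  proof -
    have "card P \<le> card ({..<n} \<times> {..<n})" unfolding P_def by (intro card_mono) auto
    then have "card P \<le> n ^ 2" by (simp add: power2_eq_square)
    then show ?thesis by (metis of_nat_le_iff of_nat_power)
  qed
  define X where "X t i i' j k = deviation p t i j * deviation p t i k * (deviation p t i' j * deviation p t i' k)" for t i i' j k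
  define Q where "Q t = (\<Sum>j<n. \<Sum>k<n. \<Sum>i<n. \<Sum>i'<n. if i \<noteq> i' \<and> j \<noteq> k then X t i i' j k else 0)" for t
  define R where "R t = (\<Sum>j<n. \<Sum>k<n. (\<Sum>i<n. deviation p t i j * deviation p t i k)\<^sup>2)" for t
  define \<Psi> where "\<Psi> t = Q t - c * (\<Sum>e\<in>P. t e - p)" for t
  have affQ: "Q (t(e := p)) = p * Q (t(e := 1)) + (1 - p) * Q (t(e := 0))" for t e
    unfolding Q_def sum_distrib_left sum.distrib[symmetric]
    by (intro sum.cong refl) (auto simp: X_def intro: deviation_4_cycle_affine)
  have affL: "(\<Sum>x\<in>P. (t(e := p)) x - p) = p * (\<Sum>x\<in>P. (t(e := 1)) x - p) + (1 - p) * (\<Sum>x\<in>P. (t(e := 0)) x - p)" for t e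
    unfolding sum_distrib_left sum.distrib[symmetric]
    by (intro sum.cong refl) (auto simp: algebra_simps)
  have "\<Psi> (t(e := p)) = p * \<Psi> (t(e := 1)) + (1 - p) * \<Psi> (t(e := 0))" for t e
    unfolding \<Psi>_def affQ affL by (simp add: algebra_simps)
  from exists_vertex_le_multiaffine[OF P p this] obtain A where
    A: "A \<subseteq> P" "\<Psi> (\<lambda>e. of_bool (e \<in> A)) \<le> \<Psi> (\<lambda>e. if e \<in> P then p else 0)" by blast
  have in_P: "(min i j, max i j) \<in> P" if "i \<noteq> j" "i < n" "j < n" for i j
    using that by (auto simp: P_def min_def max_def)
  have "deviation p (\<lambda>e. if e \<in> P then p else 0) i j = 0" if "i < n" "j < n" for i j
    using in_P[of i j] that by (cases "i = j") (auto simp: deviation_def order_sign_def)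
  then have "\<Psi> (\<lambda>e. if e \<in> P then p else 0) = 0"
    unfolding \<Psi>_def Q_def X_def by (auto intro!: sum.neutral)
  define t :: "nat \<times> nat \<Rightarrow> real" where "t = (\<lambda>e. of_bool (e \<in> A))"
  have "\<Psi> t \<le> 0" using A(2) \<open>\<Psi> (\<lambda>e. if e \<in> P then p else 0) = 0\<close> by (simp add: t_def)
  moreover have sumA: "(\<Sum>e\<in>P. t e - p) = real (card A) - p * real (card P)"
    using A(1) P by (simp add: t_def sum_subtractf Int_absorb1)
  ultimately have Q: "Q t \<le> c * (real (card A) - p * real (card P))" by (simp add: \<Psi>_def)
  have dev: "\<bar>deviation p t i j\<bar> \<le> 1" for i j
    using p by (auto simp: deviation_def order_sign_def t_def)
  have X1: "\<bar>X t i i' j k\<bar> \<le> 1" for i i' j k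
    unfolding X_def abs_mult by (intro mult_le_one dev) auto
  have "R t = (\<Sum>j<n. \<Sum>k<n. \<Sum>i<n. \<Sum>i'<n. X t i i' j k)"
    by (simp add: R_def X_def power2_eq_square sum_product)
  also have "\<dots> \<le> (\<Sum>j<n. \<Sum>k<n. \<Sum>i<n. \<Sum>i'<n. (if i' = i then 1 else 0) + (if k = j then 1 else 0)
                     + (if i \<noteq> i' \<and> j \<noteq> k then X t i i' j k else 0))"
  proof (intro sum_mono)
    fix j k i i'
    show "X t i i' j k \<le> (if i' = i then 1 else 0) + (if k = j then 1 else 0)
                     + (if i \<noteq> i' \<and> j \<noteq> k then X t i i' j k else 0)"
      using abs_le_D1[OF X1[of i i' j k]] by (auto split: if_splits)
  qed
  also have "\<dots> = 2 * real n ^ 3 + Q t"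
    by (simp add: sum.distrib Q_def eval_nat_numeral sum.delta sum_distrib_left[symmetric])
  finally have RQ: "R t \<le> 2 * real n ^ 3 + Q t" .
  have "R t \<ge> 0" by (simp add: R_def sum_nonneg)
  then have "c * (real (card A) - p * real (card P)) \<ge> - (2 * real n ^ 3)" using RQ Q by linarith
  then have "real (card A) \<ge> p * real (card P) - 2 * real n ^ 3 / c"
    using c by (simp add: field_simps)
  moreover have "R t \<le> 2 * real n ^ 3 + c * real n ^ 2"
  proof -
    have "real (card A) - p * real (card P) \<le> real n ^ 2"
      using card_mono[OF P A(1)] cP p mult_nonneg_nonneg[of p "real (card P)"] by linarith
    then have "c * (real (card A) - p * real (card P)) \<le> c * real n ^ 2"
      using c by (intro mult_left_mono) auto
    then show ?thesis using RQ Q by linarith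
  qed
  ultimately show ?thesis using A(1) unfolding R_def t_def by blast
qed

section \<open>Sums over all orderings\<close>

lemma bij_betw_rank:
  fixes \<phi> :: "'a \<Rightarrow> nat"
  assumes V: "finite V" and inj: "inj_on \<phi> V"
  defines "r \<equiv> \<lambda>v. card {w \<in> V. \<phi> w < \<phi> v}"
  shows "bij_betw r V {..<card V}"
    and "\<And>u v. u \<in> V \<Longrightarrow> v \<in> V \<Longrightarrow> order_sign (r u) (r v) = order_sign (\<phi> u) (\<phi> v)"
proof -
  have mono: "r u < r v" if "u \<in> V" "v \<in> V" "\<phi> u < \<phi> v" for u v
    unfolding r_def by (rule psubset_card_mono) (use V that in auto)
  have inj_r: "inj_on r V"
  proof (rule inj_onI)
    fix u v assume "u \<in> V" "v \<in> V" "r u = r v"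
    then show "u = v"
      using mono[of u v] mono[of v u] inj_onD[OF inj, of u v] by (metis less_irrefl linorder_neqE_nat)
  qed
  have "r v < card V" if "v \<in> V" for v
    unfolding r_def by (rule psubset_card_mono) (use V that in auto)
  then have "r ` V \<subseteq> {..<card V}" by auto
  moreover have "card (r ` V) = card {..<card V}" using inj_r by (simp add: card_image)
  ultimately have "r ` V = {..<card V}" by (intro card_subset_eq) auto
  with inj_r show "bij_betw r V {..<card V}" by (simp add: bij_betw_def)
  show "order_sign (r u) (r v) = order_sign (\<phi> u) (\<phi> v)" if "u \<in> V" "v \<in> V" for u v
    using mono[of u v] mono[of v u] that inj_onD[OF inj, of u v]
    by (cases "\<phi> u" "\<phi> v" rule: linorder_cases) (auto simp: order_sign_def)
qed

lemma permutation_between_orderings: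
  fixes \<phi> \<phi>' :: "'a \<Rightarrow> nat"
  assumes V: "finite V" and inj: "inj_on \<phi> V" "inj_on \<phi>' V"
  obtains q where "q permutes V"
    "\<And>u v. u \<in> V \<Longrightarrow> v \<in> V \<Longrightarrow> order_sign (\<phi>' (q u)) (\<phi>' (q v)) = order_sign (\<phi> u) (\<phi> v)"
proof -
  define r r' where "r = (\<lambda>v. card {w \<in> V. \<phi> w < \<phi> v})" and "r' = (\<lambda>v. card {w \<in> V. \<phi>' w < \<phi>' v})"
  have rank: "bij_betw r V {..<card V}"
      "\<And>u v. u \<in> V \<Longrightarrow> v \<in> V \<Longrightarrow> order_sign (r u) (r v) = order_sign (\<phi> u) (\<phi> v)"
      "bij_betw r' V {..<card V}"
      "\<And>u v. u \<in> V \<Longrightarrow> v \<in> V \<Longrightarrow> order_sign (r' u) (r' v) = order_sign (\<phi>' u) (\<phi>' v)"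
    unfolding r_def r'_def using bij_betw_rank[OF V inj(1)] bij_betw_rank[OF V inj(2)] by blast+
  define q where "q v = (if v \<in> V then inv_into V r' (r v) else v)" for v
  have q: "bij_betw (inv_into V r' \<circ> r) V V"
    using rank by (blast intro: bij_betw_trans bij_betw_inv_into)
  have qV: "q v \<in> V" "r' (q v) = r v" if "v \<in> V" for v
  proof -
    have "r v \<in> r' ` V" using that rank(1,3) by (auto simp: bij_betw_def)
    then show "q v \<in> V" "r' (q v) = r v"
      using that by (auto simp: q_def inv_into_into f_inv_into_f)
  qed
  have "bij_betw q V V" using q by (subst bij_betw_cong[of _ _ "inv_into V r' \<circ> r"]) (auto simp: q_def)
  then have "q permutes V" by (rule bij_imp_permutes) (simp add: q_def)
  moreover have "order_sign (\<phi>' (q u)) (\<phi>' (q v)) = order_sign (\<phi> u) (\<phi> v)" if "u \<in> V" "v \<in> V" for u v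
    using rank(2)[of u v] rank(4)[of "q u" "q v"] that qV[of u] qV[of v] by simp
  ultimately show thesis using that by blast
qed

text \<open>
  The maps \<open>\<phi> \<circ> p\<close> run through all orderings of \<open>V\<close> whatever the injective map \<open>\<phi>\<close> is.
\<close>

lemma sum_orderings_cong:
  fixes F :: "('a \<Rightarrow> nat) \<Rightarrow> real"
  assumes V: "finite V" and inj: "inj_on \<phi> V" "inj_on \<phi>' V"
    and F: "\<And>\<psi> \<psi>'. (\<And>u v. u \<in> V \<Longrightarrow> v \<in> V \<Longrightarrow> order_sign (\<psi> u) (\<psi> v) = order_sign (\<psi>' u) (\<psi>' v)) \<Longrightarrow> F \<psi> = F \<psi>'"
  shows "(\<Sum>p | p permutes V. F (\<phi> \<circ> p)) = (\<Sum>p | p permutes V. F (\<phi>' \<circ> p))"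
proof -
  obtain q where q: "q permutes V"
    "\<And>u v. u \<in> V \<Longrightarrow> v \<in> V \<Longrightarrow> order_sign (\<phi>' (q u)) (\<phi>' (q v)) = order_sign (\<phi> u) (\<phi> v)"
    using permutation_between_orderings[OF V inj] by blast
  have "(\<Sum>p | p permutes V. F (\<phi>' \<circ> p)) = (\<Sum>p | p permutes V. F (\<phi>' \<circ> (q \<circ> p)))"
    by (rule setum_permutations_compose_left[OF q(1)])
  also have "\<dots> = (\<Sum>p | p permutes V. F (\<phi> \<circ> p))"
    by (intro sum.cong refl F) (use q(2) in \<open>auto simp: permutes_in_image\<close>)
  finally show ?thesis ..
qed

lemma card_non_injective_le:
  fixes U :: "'b set"
  assumes V: "finite V" and U: "finite U"
  shows "card U ^ card V - card {\<phi> \<in> V \<rightarrow>\<^sub>E U. inj_on \<phi> V} \<le> card V ^ 2 * card U ^ (card V - 1)"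
proof -
  define B where "B u v = {\<phi> \<in> V \<rightarrow>\<^sub>E U. \<phi> u = \<phi> v}" for u v
  have fin: "finite (V \<rightarrow>\<^sub>E U)" by (intro finite_PiE V U)
  have B: "card (B u v) \<le> card U ^ (card V - 1)" if "u \<in> V" "v \<in> V" "u \<noteq> v" for u v
  proof -
    have "card (B u v) \<le> card (V - {u} \<rightarrow>\<^sub>E U)"
    proof (rule card_inj_on_le[where f = "\<lambda>\<phi>. restrict \<phi> (V - {u})"])
      show "inj_on (\<lambda>\<phi>. restrict \<phi> (V - {u})) (B u v)"
      proof (rule inj_onI)
        fix \<phi> \<psi> assume *: "\<phi> \<in> B u v" "\<psi> \<in> B u v" and eq: "restrict \<phi> (V - {u}) = restrict \<psi> (V - {u})"
        have **: "\<phi> w = \<psi> w" if "w \<in> V" "w \<noteq> u" for w using fun_cong[OF eq, of w] that by simp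
        show "\<phi> = \<psi>"
        proof (rule PiE_ext)
          show "\<phi> \<in> V \<rightarrow>\<^sub>E U" "\<psi> \<in> V \<rightarrow>\<^sub>E U" using * by (simp_all add: B_def)
          show "\<phi> w = \<psi> w" if "w \<in> V" for w
            using * **[of w] **[of v] that \<open>v \<in> V\<close> \<open>u \<noteq> v\<close> by (cases "w = u") (simp_all add: B_def)
        qed
      qed
    qed (auto simp: B_def PiE_iff intro: V U finite_PiE split: if_splits)
    then show ?thesis using V that by (simp add: card_funcsetE)
  qed
  define D where "D = {p \<in> V \<times> V. fst p \<noteq> snd p}"
  have D: "finite D" "card D \<le> card V ^ 2"
    using card_mono[of "V \<times> V" D] V by (auto simp: D_def power2_eq_square)
  have sub: "V \<rightarrow>\<^sub>E U \<subseteq> {\<phi> \<in> V \<rightarrow>\<^sub>E U. inj_on \<phi> V} \<union> (\<Union>p\<in>D. B (fst p) (snd p))"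
    by (auto simp: inj_on_def B_def D_def)
  have "card U ^ card V = card (V \<rightarrow>\<^sub>E U)" using V by (simp add: card_funcsetE)
  also have "\<dots> \<le> card ({\<phi> \<in> V \<rightarrow>\<^sub>E U. inj_on \<phi> V} \<union> (\<Union>p\<in>D. B (fst p) (snd p)))"
    by (rule card_mono[OF _ sub]) (use fin D in \<open>auto simp: B_def\<close>)
  also have "\<dots> \<le> card {\<phi> \<in> V \<rightarrow>\<^sub>E U. inj_on \<phi> V} + card (\<Union>p\<in>D. B (fst p) (snd p))"
    by (rule card_Un_le)
  also have "card (\<Union>p\<in>D. B (fst p) (snd p)) \<le> (\<Sum>p\<in>D. card (B (fst p) (snd p)))"
    by (rule card_UN_le[OF D(1)])
  also have "\<dots> \<le> card D * card U ^ (card V - 1)"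
    using sum_bounded_above[of D "\<lambda>p. card (B (fst p) (snd p))" "card U ^ (card V - 1)"] B by (auto simp: D_def)
  also have "\<dots> \<le> card V ^ 2 * card U ^ (card V - 1)"
    using D(2) by (rule mult_right_mono) simp
  finally show ?thesis by simp
qed

lemma sum_funcset_permute:
  fixes F :: "('a \<Rightarrow> 'b) \<Rightarrow> real"
  assumes p: "p permutes V"
  shows "(\<Sum>\<phi>\<in>V \<rightarrow>\<^sub>E U. F (\<phi> \<circ> p)) = (\<Sum>\<phi>\<in>V \<rightarrow>\<^sub>E U. F \<phi>)"
proof (rule sum.reindex_bij_betw[OF bij_betw_byWitness[where f' = "\<lambda>\<phi>. \<phi> \<circ> inv p"]])
  have comp: "\<phi> \<circ> q \<in> V \<rightarrow>\<^sub>E U" if "q permutes V" "\<phi> \<in> V \<rightarrow>\<^sub>E U" for \<phi> :: "'a \<Rightarrow> 'b" and q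
    using that by (auto simp: PiE_iff extensional_def permutes_in_image permutes_not_in)
  show "(\<lambda>\<phi>. \<phi> \<circ> p) ` (V \<rightarrow>\<^sub>E U) \<subseteq> V \<rightarrow>\<^sub>E U" using comp[OF p] by auto
  show "(\<lambda>\<phi>. \<phi> \<circ> inv p) ` (V \<rightarrow>\<^sub>E U) \<subseteq> V \<rightarrow>\<^sub>E U" using comp[OF permutes_inv[OF p]] by auto
qed (simp_all only: comp_assoc permutes_inv_o[OF p] comp_id ball_triv simp_thms)

section \<open>Embeddings into a biased kernel\<close>

context tournament
begin

lemma finite_V [simp]: "finite (pverts T)" and finite_E [simp]: "finite (parcs T)"
  by (rule pair_finite_verts pair_finite_arcs)+

lemma arcD: "(u, v) \<in> parcs T \<Longrightarrow> u \<in> pverts T \<and> v \<in> pverts T \<and> u \<noteq> v \<and> (v, u) \<notin> parcs T"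
  using wellformed' pair_no_loops[of "(u, v)"] exactly_one_arc[of u v] by auto

lemma card_arcs: "card (parcs T) = card (pverts T) choose 2"
proof -
  have "bij_betw (\<lambda>(u, v). {u, v}) (parcs T) {B. B \<subseteq> pverts T \<and> card B = 2}"
    unfolding bij_betw_def
  proof
    show "inj_on (\<lambda>(u, v). {u, v}) (parcs T)"
      by (auto simp: inj_on_def doubleton_eq_iff dest: arcD)
    show "(\<lambda>(u, v). {u, v}) ` parcs T = {B. B \<subseteq> pverts T \<and> card B = 2}"
    proof (intro equalityI subsetI)
      fix B assume "B \<in> {B. B \<subseteq> pverts T \<and> card B = 2}"
      then obtain u v where B: "B = {u, v}" "u \<noteq> v" "u \<in> pverts T" "v \<in> pverts T"
        by (auto simp: card_2_iff)
      then have "(u, v) \<in> parcs T \<or> (v, u) \<in> parcs T" using exactly_one_arc by blast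
      then show "B \<in> (\<lambda>(u, v). {u, v}) ` parcs T"
        using B(1) by (auto simp: image_iff insert_commute intro: bexI[of _ "(u, v)"] bexI[of _ "(v, u)"])
    qed (auto dest: arcD)
  qed
  then show ?thesis by (simp add: bij_betw_same_card n_subsets)
qed

lemma surplus_cong:
  "(\<And>u v. u \<in> pverts T \<Longrightarrow> v \<in> pverts T \<Longrightarrow> order_sign (\<phi> u) (\<phi> v) = order_sign (\<psi> u) (\<psi> v)) \<Longrightarrow>
     surplus (parcs T) \<phi> = surplus (parcs T) \<psi>"
  unfolding surplus_def by (intro sum.cong) (auto dest: arcD)

lemma order_weight_cong:
  "(\<And>u v. u \<in> pverts T \<Longrightarrow> v \<in> pverts T \<Longrightarrow> order_sign (\<phi> u) (\<phi> v) = order_sign (\<psi> u) (\<psi> v)) \<Longrightarrow>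
     order_weight (parcs T) x \<phi> = order_weight (parcs T) x \<psi>"
  unfolding order_weight_def by (intro prod.cong) (auto dest: arcD)

text \<open>
  Averaging over the permutations of the vertices turns the contribution of an injective \<open>\<phi>\<close> into the
  sum of all order weights. If that sum is \<open>h!\<close>, the total is the same as for the kernel that is
  constantly \<open>1/2\<close>.
\<close>

lemma sum_biased_kernel:
  fixes U :: "nat set"
  assumes U: "finite U"
    and Z: "\<And>\<phi>. inj_on \<phi> (pverts T) \<Longrightarrow> (\<Sum>p | p permutes pverts T. order_weight (parcs T) x (\<phi> \<circ> p)) = fact (card (pverts T))"
  shows "(\<Sum>\<phi>\<in>pverts T \<rightarrow>\<^sub>E U. \<Prod>(u, v)\<in>parcs T. biased_kernel x (\<phi> u) (\<phi> v))
     = real (card {\<phi> \<in> pverts T \<rightarrow>\<^sub>E U. inj_on \<phi> (pverts T)}) * (1/2) ^ (card (pverts T) choose 2)"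
proof -
  define F :: "('a \<Rightarrow> nat) \<Rightarrow> real" where
    "F \<phi> = (\<Prod>(u, v)\<in>parcs T. biased_kernel x (\<phi> u) (\<phi> v))" for \<phi>
  let ?h = "card (pverts T)"
  have F_inj: "F \<phi> = order_weight (parcs T) x \<phi> * (1/2) ^ (?h choose 2)" if "inj_on \<phi> (pverts T)" for \<phi>
  proof -
    have "F \<phi> = (\<Prod>(u, v)\<in>parcs T. (1 + x * order_sign (\<phi> u) (\<phi> v)) * (1/2))"
      unfolding F_def biased_kernel_def by (intro prod.cong) (use that in \<open>auto dest!: arcD simp: inj_on_def\<close>)
    then show ?thesis
      by (simp add: order_weight_def case_prod_unfold prod_dividef prod.distrib card_arcs power_divide)
  qed
  have F_non_inj: "F \<phi> = 0" if non_inj: "\<not> inj_on \<phi> (pverts T)" for \<phi>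
  proof -
    obtain u v where uv: "u \<in> pverts T" "v \<in> pverts T" "u \<noteq> v" "\<phi> u = \<phi> v"
      using non_inj unfolding inj_on_def by blast
    then have "(u, v) \<in> parcs T \<or> (v, u) \<in> parcs T" using exactly_one_arc by blast
    then show ?thesis
      using uv unfolding F_def by (intro prod_zero) (auto simp: biased_kernel_def intro: bexI[of _ "(u, v)"] bexI[of _ "(v, u)"])
  qed
  have orbit: "(\<Sum>p | p permutes pverts T. F (\<phi> \<circ> p)) = fact ?h * (of_bool (inj_on \<phi> (pverts T)) * (1/2) ^ (?h choose 2))" for \<phi>
  proof -
    have iff: "inj_on (\<phi> \<circ> p) (pverts T) \<longleftrightarrow> inj_on \<phi> (pverts T)" if "p permutes pverts T" for p
      using comp_inj_on_iff[of p "pverts T" \<phi>] permutes_inj_on[OF that] permutes_image[OF that] by auto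
    show ?thesis
    proof (cases "inj_on \<phi> (pverts T)")
      case True
      then show ?thesis
        using Z[OF True] iff by (simp add: F_inj sum_distrib_right[symmetric])
    next
      case False
      then show ?thesis using iff by (simp add: F_non_inj)
    qed
  qed
  have "fact ?h * (\<Sum>\<phi>\<in>pverts T \<rightarrow>\<^sub>E U. F \<phi>) = (\<Sum>p | p permutes pverts T. \<Sum>\<phi>\<in>pverts T \<rightarrow>\<^sub>E U. F (\<phi> \<circ> p))"
    by (simp add: sum_funcset_permute card_permutations)
  also have "\<dots> = (\<Sum>\<phi>\<in>pverts T \<rightarrow>\<^sub>E U. \<Sum>p | p permutes pverts T. F (\<phi> \<circ> p))"
    by (rule sum.swap)
  also have "\<dots> = fact ?h * (\<Sum>\<phi>\<in>pverts T \<rightarrow>\<^sub>E U. of_bool (inj_on \<phi> (pverts T)) * (1/2) ^ (?h choose 2))"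
    unfolding orbit by (simp add: sum_distrib_left)
  also have "(\<Sum>\<phi>\<in>pverts T \<rightarrow>\<^sub>E U. of_bool (inj_on \<phi> (pverts T)) * (1/2::real) ^ (?h choose 2))
     = real (card {\<phi> \<in> pverts T \<rightarrow>\<^sub>E U. inj_on \<phi> (pverts T)}) * (1/2) ^ (?h choose 2)"
    using finite_PiE[OF finite_V U] by (simp add: sum_distrib_right[symmetric] Int_def)
  finally show ?thesis unfolding F_def by simp
qed

text \<open>
  In a tournament it suffices that arcs are mapped to arcs: the pair of two distinct vertices that is
  not an arc is reversed to one.
\<close>

lemma num_embeddings_eq_sum:
  assumes G: "tournament G" and U: "U \<subseteq> pverts G"
  shows "real (num_embeddings_in G T U) = (\<Sum>\<phi>\<in>pverts T \<rightarrow>\<^sub>E U. \<Prod>(u, v)\<in>parcs T. of_bool ((\<phi> u, \<phi> v) \<in> parcs G))"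
proof -
  interpret G: tournament G by fact
  have fU: "finite U" using U G.finite_V finite_subset by blast
  have ends: "arcs_ends (with_proj G \<restriction> U) = {(i, j) \<in> parcs G. i \<in> U \<and> j \<in> U}"
    by (auto simp: arcs_ends_def induce_subgraph_def arc_to_ends_def image_iff)
  have iff: "(\<forall>u\<in>pverts T. \<forall>v\<in>pverts T. (u, v) \<in> parcs T \<longleftrightarrow> (\<phi> u, \<phi> v) \<in> {(i, j) \<in> parcs G. i \<in> U \<and> j \<in> U})
        \<longleftrightarrow> (\<forall>(u, v)\<in>parcs T. (\<phi> u, \<phi> v) \<in> parcs G)" (is "?L \<longleftrightarrow> ?R")
    if "\<phi> \<in> pverts T \<rightarrow>\<^sub>E U" for \<phi>
  proof
    assume ?L then show ?R by (auto dest: arcD)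
  next
    assume R: ?R
    show ?L
    proof (intro ballI iffI)
      fix u v assume uv: "u \<in> pverts T" "v \<in> pverts T"
      have in_U: "\<phi> u \<in> U" "\<phi> v \<in> U" using that uv by auto
      show "(\<phi> u, \<phi> v) \<in> {(i, j) \<in> parcs G. i \<in> U \<and> j \<in> U}" if "(u, v) \<in> parcs T"
        using that R in_U by auto
      show "(u, v) \<in> parcs T" if "(\<phi> u, \<phi> v) \<in> {(i, j) \<in> parcs G. i \<in> U \<and> j \<in> U}"
      proof (rule ccontr)
        assume "(u, v) \<notin> parcs T"
        moreover have "u \<noteq> v" using that by (auto dest: G.arcD)
        ultimately have "(v, u) \<in> parcs T" using exactly_one_arc uv by blast
        then have "(\<phi> v, \<phi> u) \<in> parcs G" using R by auto
        then show False using that by (auto dest: G.arcD)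
      qed
    qed
  qed
  have "labelled_embeddings (with_proj T) (with_proj G \<restriction> U)
      = {\<phi> \<in> pverts T \<rightarrow>\<^sub>E U. \<forall>(u, v)\<in>parcs T. (\<phi> u, \<phi> v) \<in> parcs G}"
  proof -
    have "labelled_embeddings (with_proj T) (with_proj G \<restriction> U)
      = {\<phi> \<in> pverts T \<rightarrow>\<^sub>E U. \<forall>u\<in>pverts T. \<forall>v\<in>pverts T.
           (u, v) \<in> parcs T \<longleftrightarrow> (\<phi> u, \<phi> v) \<in> {(i, j) \<in> parcs G. i \<in> U \<and> j \<in> U}}"
      unfolding labelled_embeddings_def ends by (simp add: induce_subgraph_def)
    then show ?thesis using iff by (simp cong: conj_cong)
  qed
  moreover have "(\<Prod>(u, v)\<in>parcs T. of_bool ((\<phi> u, \<phi> v) \<in> parcs G)) = (of_bool (\<forall>(u, v)\<in>parcs T. (\<phi> u, \<phi> v) \<in> parcs G) :: real)" for \<phi>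
  proof (cases "\<forall>(u, v)\<in>parcs T. (\<phi> u, \<phi> v) \<in> parcs G")
    case False
    then obtain u v where uv: "(u, v) \<in> parcs T" "(\<phi> u, \<phi> v) \<notin> parcs G" by auto
    then have "(\<Prod>(u, v)\<in>parcs T. of_bool ((\<phi> u, \<phi> v) \<in> parcs G)) = (0 :: real)"
      by (intro prod_zero) (auto intro: bexI[of _ "(u, v)"])
    then show ?thesis using uv by auto
  qed (auto intro!: prod.neutral)
  ultimately show ?thesis
    using finite_PiE[OF finite_V fU] by (simp add: num_embeddings_in_def Int_def)
qed

end

section \<open>Random-like tournaments with a bias\<close>

lemma real_choose_two: "real (n choose 2) = real n * (real n - 1) / 2"
  by (induction n) (simp_all add: numeral_2_eq_2 field_simps)

text \<open>
  Here \<open>A\<close> is the set of pairs \<open>i < j\<close> that are oriented forwards.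
\<close>

definition tournament_of_pairs :: "nat \<Rightarrow> (nat \<times> nat) set \<Rightarrow> nat pair_pre_digraph" where
  "tournament_of_pairs n A =
     \<lparr>pverts = {..<n}, parcs = {(i, j). i < n \<and> j < n \<and> (i < j \<and> (i, j) \<in> A \<or> j < i \<and> (j, i) \<notin> A)}\<rparr>"

lemma tournament_of_pairs_simps [simp]:
  "pverts (tournament_of_pairs n A) = {..<n}"
  "(i, j) \<in> parcs (tournament_of_pairs n A) \<longleftrightarrow>
     i < n \<and> j < n \<and> (i < j \<and> (i, j) \<in> A \<or> j < i \<and> (j, i) \<notin> A)"
  by (auto simp: tournament_of_pairs_def)

lemma tournament_tournament_of_pairs: "tournament (tournament_of_pairs n A)"
proof unfold_locales
  show "finite (parcs (tournament_of_pairs n A))"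
    by (rule finite_subset[of _ "{..<n} \<times> {..<n}"]) auto
next
  fix e assume "e \<in> parcs (tournament_of_pairs n A)"
  moreover obtain i j where "e = (i, j)" by fastforce
  ultimately show "fst e \<in> pverts (tournament_of_pairs n A)" "snd e \<in> pverts (tournament_of_pairs n A)"
    "fst e \<noteq> snd e" by auto
qed auto

lemma forward_arcs_tournament_of_pairs:
  assumes "A \<subseteq> {(i, j). i < j \<and> j < n}"
  shows "forward_arcs Suc (tournament_of_pairs n A) = A"
  using assms by (auto simp: forward_arcs_def)

lemma card_increasing_pairs: "card {(i, j). i < j \<and> j < (n::nat)} = n choose 2"
proof -
  have "parcs (tournament_of_pairs n {(i, j). i < j \<and> j < n}) = {(i, j). i < j \<and> j < n}" by auto
  then show ?thesis
    using tournament.card_arcs[OF tournament_tournament_of_pairs[of n "{(i, j). i < j \<and> j < n}"]] by simp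
qed

lemma deviation_tournament_of_pairs:
  assumes "i < n" "j < n"
  shows "of_bool ((i, j) \<in> parcs (tournament_of_pairs n A)) - biased_kernel x i j
           = deviation ((1 + x) / 2) (\<lambda>e. of_bool (e \<in> A)) i j"
  using assms by (cases i j rule: linorder_cases)
    (auto simp: biased_kernel_def deviation_def order_sign_def field_simps)

text \<open>
  The 4-cycle sum is at most \<open>2 * n ^ 3 + c * n\<^sup>2\<close> and the loss of forward arcs \<open>2 * n ^ 3 / c\<close>;
  any \<open>c\<close> that is a small multiple of \<open>n\<^sup>2\<close> makes them small relative to \<open>n ^ 4\<close> and \<open>n\<^sup>2\<close>.
\<close>

lemma exists_quasirandom_tournament:
  fixes x \<alpha> :: real
  assumes x: "0 \<le> x" "x \<le> 1" and \<alpha>: "0 < \<alpha>"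
  shows "\<exists>N. \<forall>n\<ge>N. \<exists>G. tournament G \<and> pverts G = {..<n} \<and>
           cut_bounded n (\<alpha> * real n ^ 2) (\<lambda>i j. of_bool ((i, j) \<in> parcs G) - biased_kernel x i j) \<and>
           real (card (forward_arcs Suc G)) \<ge> (1 + x) / 2 * real (n choose 2) - \<alpha> * real n ^ 2"
proof -
  define \<gamma> where "\<gamma> = \<alpha> ^ 4 / 2"
  have \<gamma>: "0 < \<gamma>" using \<alpha> by (simp add: \<gamma>_def)
  obtain N :: nat where N: "real N \<ge> max 1 (max (2 / \<gamma>) (2 / (\<gamma> * \<alpha>)))"
    using real_arch_simple by blast
  show ?thesis
  proof (intro exI[of _ N] allI impI)
    fix n assume n: "N \<le> n"
    have rn: "real n \<ge> 1" "real n \<ge> 2 / \<gamma>" "real n \<ge> 2 / (\<gamma> * \<alpha>)" using n N by auto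
    define c where "c = \<gamma> * real n ^ 2"
    have c: "c > 0" using \<gamma> rn by (simp add: c_def)
    define p where "p = (1 + x) / 2"
    have p: "0 \<le> p" "p \<le> 1" using x by (auto simp: p_def)
    obtain A where A: "A \<subseteq> {(i, j). i < j \<and> j < n}"
      "(\<Sum>j<n. \<Sum>k<n. (\<Sum>i<n. deviation p (\<lambda>e. of_bool (e \<in> A)) i j * deviation p (\<lambda>e. of_bool (e \<in> A)) i k)\<^sup>2)
             \<le> 2 * real n ^ 3 + c * real n ^ 2"
      "real (card A) \<ge> p * real (n choose 2) - 2 * real n ^ 3 / c"
      using exists_quasirandom_deviation[OF p c] unfolding card_increasing_pairs by blast
    let ?G = "tournament_of_pairs n A"
    have "cut_bounded n (\<alpha> * real n ^ 2) (deviation p (\<lambda>e. of_bool (e \<in> A)))"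
    proof (rule cut_bounded_if_few_4_cycles[OF A(2)])
      have "2 * real n ^ 3 \<le> \<gamma> * real n ^ 4"
        using rn(2) \<gamma> mult_right_mono[of 2 "\<gamma> * real n" "real n ^ 3"]
        by (simp add: field_simps eval_nat_numeral)
      then have "2 * real n ^ 3 + c * real n ^ 2 \<le> 2 * \<gamma> * real n ^ 4"
        by (simp add: c_def algebra_simps flip: power_add)
      then have "real n ^ 4 * (2 * real n ^ 3 + c * real n ^ 2) \<le> real n ^ 4 * (2 * \<gamma> * real n ^ 4)"
        by (rule mult_left_mono) simp
      also have "\<dots> = (\<alpha> * real n ^ 2) ^ 4"
        by (simp add: \<gamma>_def power_mult_distrib flip: power_mult power_add)
      finally show "real n ^ 4 * (2 * real n ^ 3 + c * real n ^ 2) \<le> (\<alpha> * real n ^ 2) ^ 4" .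
    qed (use \<alpha> in simp)
    then have "cut_bounded n (\<alpha> * real n ^ 2) (\<lambda>i j. of_bool ((i, j) \<in> parcs ?G) - biased_kernel x i j)"
      unfolding cut_bounded_def by (simp add: deviation_tournament_of_pairs p_def del: tournament_of_pairs_simps)
    moreover have "2 * real n ^ 3 / c \<le> \<alpha> * real n ^ 2"
      using rn \<gamma> \<alpha> by (simp add: c_def field_simps eval_nat_numeral)
    ultimately show "\<exists>G. tournament G \<and> pverts G = {..<n} \<and>
           cut_bounded n (\<alpha> * real n ^ 2) (\<lambda>i j. of_bool ((i, j) \<in> parcs G) - biased_kernel x i j) \<and>
           real (card (forward_arcs Suc G)) \<ge> (1 + x) / 2 * real (n choose 2) - \<alpha> * real n ^ 2"
      using A(3) tournament_tournament_of_pairs[of n A] forward_arcs_tournament_of_pairs[OF A(1)]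
      by (intro exI[of _ ?G]) (auto simp: p_def)
  qed
qed

section \<open>The order weights of a locally forcing tournament\<close>

context tournament
begin

lemma transitive_tournamentI:
  assumes inj: "inj_on \<phi> (pverts T)" and fwd: "\<And>u v. (u, v) \<in> parcs T \<Longrightarrow> \<phi> u < (\<phi> v :: nat)"
  shows "transitive_tournament T"
proof -
  define r where "r v = card {w \<in> pverts T. \<phi> w < \<phi> v}" for v
  have r: "bij_betw r (pverts T) {..<card (pverts T)}"
    "\<And>u v. u \<in> pverts T \<Longrightarrow> v \<in> pverts T \<Longrightarrow> order_sign (r u) (r v) = order_sign (\<phi> u) (\<phi> v)"
    unfolding r_def using bij_betw_rank[OF finite_V inj] by blast+
  have "bij_betw (Suc \<circ> r) (pverts T) {1..card (pverts T)}"
    by (rule bij_betw_trans[OF r(1)]) (simp add: bij_betw_def lessThan_atLeast0 image_Suc_atLeastLessThan atLeastLessThanSuc_atLeastAtMost)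
  moreover have "r u < r v" if "(u, v) \<in> parcs T" for u v
    using r(2)[of u v] fwd[OF that] arcD[OF that] by (auto simp: order_sign_def split: if_splits)
  then have "forward_arcs (Suc \<circ> r) T = parcs T" by (auto simp: forward_arcs_def)
  ultimately show ?thesis unfolding transitive_tournament_def is_ordering_def by blast
qed

text \<open>
  The first error term comes from the counting lemma, the second one from the maps that are not
  injective.
\<close>

lemma embeddings_in_quasirandom_tournament:
  assumes G: "tournament G" "pverts G = {..<n}"
    and cut: "cut_bounded n (\<alpha> * real n ^ 2) (\<lambda>i j. of_bool ((i, j) \<in> parcs G) - biased_kernel x i j)"
    and x: "0 \<le> x" "x \<le> 1" and \<alpha>: "0 \<le> \<alpha>"
    and Z: "\<And>\<phi>. inj_on \<phi> (pverts T) \<Longrightarrow> (\<Sum>p | p permutes pverts T. order_weight (parcs T) x (\<phi> \<circ> p)) = fact (card (pverts T))"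
    and U: "U \<subseteq> pverts G"
  defines "h \<equiv> card (pverts T)"
  shows "\<bar>real (num_embeddings_in G T U) - (1/2) ^ (h choose 2) * real (card U) ^ h\<bar>
           \<le> real (card (parcs T)) * \<alpha> * real n ^ h + real h ^ 2 * real n ^ (h - 1)"
proof -
  have fU: "finite U" and Un: "U \<subseteq> {..<n}" using U G(2) finite_subset by auto
  have cU: "card U \<le> n" using card_mono[OF _ Un] by simp
  define I where "I = real (card {\<phi> \<in> pverts T \<rightarrow>\<^sub>E U. inj_on \<phi> (pverts T)})"
  have kernel: "(\<Sum>\<phi>\<in>pverts T \<rightarrow>\<^sub>E U. \<Prod>(u, v)\<in>parcs T. biased_kernel x (\<phi> u) (\<phi> v)) = I * (1/2) ^ (h choose 2)"
    unfolding I_def h_def by (rule sum_biased_kernel[OF fU]) (rule Z)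
  have "\<bar>real (num_embeddings_in G T U) - I * (1/2) ^ (h choose 2)\<bar>
      \<le> real (card (parcs T)) * (\<alpha> * real n ^ 2 * real n ^ (h - 2))"
    unfolding num_embeddings_eq_sum[OF G(1) U] kernel[symmetric] unfolding h_def
    by (rule counting_lemma[OF cut]) (use x Un in \<open>auto dest: arcD simp: biased_kernel_def order_sign_def\<close>)
  also have "\<dots> = real (card (parcs T)) * \<alpha> * real n ^ h"
  proof (cases "h \<ge> 2")
    case True
    then have "real n ^ 2 * real n ^ (h - 2) = real n ^ h" by (metis le_add_diff_inverse power_add)
    then show ?thesis by (simp only: mult.assoc)
  next
    case False
    then have "h choose 2 = 0" by (intro binomial_eq_0) simp
    then show ?thesis using card_arcs by (simp add: h_def)
  qed
  finally have 1: "\<bar>real (num_embeddings_in G T U) - I * (1/2) ^ (h choose 2)\<bar> \<le> real (card (parcs T)) * \<alpha> * real n ^ h" .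
  have I_le: "I \<le> real (card U) ^ h"
  proof -
    have "card {\<phi> \<in> pverts T \<rightarrow>\<^sub>E U. inj_on \<phi> (pverts T)} \<le> card (pverts T \<rightarrow>\<^sub>E U)"
      by (rule card_mono) (auto intro: finite_PiE fU)
    then show ?thesis unfolding I_def h_def by (simp add: card_funcsetE flip: of_nat_power)
  qed
  have "real (card U ^ h) \<le> real (card {\<phi> \<in> pverts T \<rightarrow>\<^sub>E U. inj_on \<phi> (pverts T)} + h ^ 2 * card U ^ (h - 1))"
    using card_non_injective_le[OF finite_V fU] unfolding of_nat_le_iff h_def by linarith
  then have "real (card U) ^ h - I \<le> real h ^ 2 * real (card U) ^ (h - 1)"
    unfolding I_def by simp
  also have "\<dots> \<le> real h ^ 2 * real n ^ (h - 1)"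
    using cU by (auto intro!: mult_left_mono power_mono)
  finally have I_ge: "real (card U) ^ h - I \<le> real h ^ 2 * real n ^ (h - 1)" .
  have "\<bar>I * (1/2) ^ (h choose 2) - (1/2) ^ (h choose 2) * real (card U) ^ h\<bar> = (1/2) ^ (h choose 2) * (real (card U) ^ h - I)"
    using I_le by (simp add: abs_mult algebra_simps flip: right_diff_distrib)
  also have "\<dots> \<le> 1 * (real (card U) ^ h - I)"
    using I_le by (intro mult_right_mono) (auto simp: power_le_one)
  finally have 2: "\<bar>I * (1/2) ^ (h choose 2) - (1/2) ^ (h choose 2) * real (card U) ^ h\<bar> \<le> real h ^ 2 * real n ^ (h - 1)"
    using I_ge by simp
  show ?thesis
    using abs_triangle_ineq[of "real (num_embeddings_in G T U) - I * (1/2) ^ (h choose 2)"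
        "I * (1/2) ^ (h choose 2) - (1/2) ^ (h choose 2) * real (card U) ^ h"] add_mono[OF 1 2] by simp
qed

text \<open>
  If the sum exceeds \<open>h!\<close> at \<open>x\<close>, it equals \<open>h!\<close> somewhere between \<open>x\<close> and 1, where it vanishes.
  For this bias random-like tournaments refute local forcing.
\<close>

lemma sum_order_weight_le_fact:
  assumes non_transitive: "\<not> transitive_tournament T" and forcing: "locally_forcing T"
    and inj: "inj_on \<phi> (pverts T)" and x: "0 \<le> x" "x < 1"
  shows "(\<Sum>p | p permutes pverts T. order_weight (parcs T) x (\<phi> \<circ> p)) \<le> fact (card (pverts T))"
proof (rule ccontr)
  define h where "h = card (pverts T)"
  define Z where "Z y = (\<Sum>p | p permutes pverts T. order_weight (parcs T) y (\<phi> \<circ> p))" for y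
  assume "\<not> ?thesis"
  then have Zx: "fact h < Z x" by (simp add: Z_def h_def)
  have "Z 1 = 0"
    unfolding Z_def
  proof (intro sum.neutral ballI)
    fix p assume "p \<in> {p. p permutes pverts T}"
    then have "inj_on (\<phi> \<circ> p) (pverts T)"
      using inj by (auto intro!: comp_inj_on permutes_inj_on simp: permutes_image)
    then obtain u v where uv: "(u, v) \<in> parcs T" "\<not> (\<phi> \<circ> p) u < (\<phi> \<circ> p) v"
      using transitive_tournamentI non_transitive by blast
    moreover have "(\<phi> \<circ> p) u \<noteq> (\<phi> \<circ> p) v"
      using \<open>inj_on (\<phi> \<circ> p) (pverts T)\<close> arcD[OF uv(1)] by (meson inj_onD)
    ultimately show "order_weight (parcs T) 1 (\<phi> \<circ> p) = 0"
      unfolding order_weight_def by (intro prod_zero) (auto intro!: bexI[of _ "(u, v)"] simp: order_sign_def)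
  qed
  moreover have "continuous_on {x..1} Z"
    unfolding Z_def order_weight_def case_prod_unfold by (intro continuous_intros)
  ultimately obtain y where y: "x \<le> y" "y \<le> 1" "Z y = fact h"
    using IVT2'[of Z 1 "fact h" x] Zx x by auto
  have y01: "0 < y" "y < 1" using y Zx \<open>Z 1 = 0\<close> x by (auto simp: less_le)
  have Zy: "(\<Sum>p | p permutes pverts T. order_weight (parcs T) y (\<psi> \<circ> p)) = fact h"
    if "inj_on \<psi> (pverts T)" for \<psi>
  proof -
    have "Z y = (\<Sum>p | p permutes pverts T. order_weight (parcs T) y (\<psi> \<circ> p))"
      unfolding Z_def by (rule sum_orderings_cong[OF finite_V inj that order_weight_cong])
    then show ?thesis using y(3) by simp
  qed
  \<comment> \<open>the natural order has about \<open>y * n\<^sup>2 / 4\<close> forward arcs more than half of all arcs\<close>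
  define \<epsilon> where "\<epsilon> = y / 16"
  have \<epsilon>: "0 < \<epsilon>" using y01 by (simp add: \<epsilon>_def)
  obtain \<delta> n0 where \<delta>: "\<delta> > 0" and forced: "\<And>(G :: nat pair_pre_digraph) n \<sigma>. tournament G \<Longrightarrow> card (pverts G) = n \<Longrightarrow> n \<ge> n0 \<Longrightarrow>
      (\<And>U. U \<subseteq> pverts G \<Longrightarrow> \<bar>real (num_embeddings_in G T U) - (1/2) ^ (h choose 2) * real (card U) ^ h\<bar>
              \<le> \<delta> * real n ^ h) \<Longrightarrow> is_ordering \<sigma> G \<Longrightarrow>
        \<bar>real (card (forward_arcs \<sigma> G)) - 1/2 * real (n choose 2)\<bar> \<le> \<epsilon> * real n ^ 2"
    using forcing[unfolded locally_forcing_def Let_def, rule_format, OF \<epsilon>] unfolding h_def by blast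
  define m where "m = real (card (parcs T))"
  define \<alpha> where "\<alpha> = min \<epsilon> (\<delta> / (2 * (m + 1)))"
  have \<alpha>: "0 < \<alpha>" "\<alpha> \<le> \<epsilon>" "m * \<alpha> \<le> \<delta> / 2"
  proof -
    have "0 \<le> m" by (simp add: m_def)
    then show "0 < \<alpha>" "\<alpha> \<le> \<epsilon>" using \<delta> \<epsilon> by (auto simp: \<alpha>_def)
    have "m * \<alpha> \<le> m * (\<delta> / (2 * (m + 1)))" using \<open>0 \<le> m\<close> by (intro mult_left_mono) (auto simp: \<alpha>_def)
    also have "\<dots> \<le> \<delta> / 2" using \<open>0 \<le> m\<close> \<delta> by (simp add: field_simps)
    finally show "m * \<alpha> \<le> \<delta> / 2" .
  qed
  obtain N where N: "\<And>n. n \<ge> N \<Longrightarrow> \<exists>G. tournament G \<and> pverts G = {..<n} \<and>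
           cut_bounded n (\<alpha> * real n ^ 2) (\<lambda>i j. of_bool ((i, j) \<in> parcs G) - biased_kernel y i j) \<and>
           real (card (forward_arcs Suc G)) \<ge> (1 + y) / 2 * real (n choose 2) - \<alpha> * real n ^ 2"
    using exists_quasirandom_tournament[of y \<alpha>] y01 \<alpha> by auto
  obtain n1 :: nat where n1: "real n1 \<ge> 2 * real h ^ 2 / \<delta>" using real_arch_simple by blast
  \<comment> \<open>at least 3, so that \<open>n choose 2\<close> exceeds \<open>n\<^sup>2 / 4\<close>\<close>
  define n where "n = Suc (Suc (Suc (max n0 (max N n1))))"
  have n: "n \<ge> n0" "n \<ge> N" "n \<ge> 3" "real n \<ge> 2 * real h ^ 2 / \<delta>"
    using n1 by (auto simp: n_def)
  from N[OF n(2)] obtain G where G: "tournament G" "pverts G = {..<n}"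
    "cut_bounded n (\<alpha> * real n ^ 2) (\<lambda>i j. of_bool ((i, j) \<in> parcs G) - biased_kernel y i j)"
    "real (card (forward_arcs Suc G)) \<ge> (1 + y) / 2 * real (n choose 2) - \<alpha> * real n ^ 2" by blast
  have "\<bar>real (num_embeddings_in G T U) - (1/2) ^ (h choose 2) * real (card U) ^ h\<bar> \<le> \<delta> * real n ^ h"
    if "U \<subseteq> pverts G" for U
  proof -
    have "\<bar>real (num_embeddings_in G T U) - (1/2) ^ (h choose 2) * real (card U) ^ h\<bar>
        \<le> m * \<alpha> * real n ^ h + real h ^ 2 * real n ^ (h - 1)"
      using embeddings_in_quasirandom_tournament[OF G(1-3) _ _ _ _ that] y01 \<alpha> Zy
      unfolding m_def h_def by simp
    also have "real h ^ 2 * real n ^ (h - 1) \<le> \<delta> / 2 * real n ^ h"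
    proof (cases h)
      case (Suc k)
      have "real h ^ 2 \<le> \<delta> / 2 * real n" using n(4) \<delta> by (simp add: field_simps)
      then have "real h ^ 2 * real n ^ k \<le> \<delta> / 2 * real n * real n ^ k" by (rule mult_right_mono) simp
      then show ?thesis using Suc by (simp add: mult_ac)
    qed (use \<delta> in simp)
    also have "m * \<alpha> * real n ^ h \<le> \<delta> / 2 * real n ^ h" using \<alpha>(3) by (rule mult_right_mono) simp
    finally show ?thesis by simp
  qed
  moreover have "is_ordering Suc G"
    using G(2) by (simp add: is_ordering_def bij_betw_def lessThan_atLeast0 image_Suc_atLeastLessThan atLeastLessThanSuc_atLeastAtMost)
  ultimately have "\<bar>real (card (forward_arcs Suc G)) - 1/2 * real (n choose 2)\<bar> \<le> \<epsilon> * real n ^ 2"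
    using forced[OF G(1) _ n(1)] G(2) by simp
  then have "y / 2 * real (n choose 2) - \<alpha> * real n ^ 2 \<le> \<epsilon> * real n ^ 2"
    using G(4) by (simp add: abs_le_iff algebra_simps add_divide_distrib)
  moreover have "\<alpha> * real n ^ 2 \<le> \<epsilon> * real n ^ 2" using \<alpha>(2) by (rule mult_right_mono) simp
  ultimately have "y / 2 * real (n choose 2) \<le> 2 * \<epsilon> * real n ^ 2" by simp
  then have "y * (real n * (real n - 1) / 4) \<le> y * (real n ^ 2 / 8)"
    by (simp add: real_choose_two \<epsilon>_def)
  then have "real n * (real n - 1) / 4 \<le> real n ^ 2 / 8" using y01 by (simp only: mult_le_cancel_left_pos)
  then have "real n * (real n - 2) \<le> 0" by (simp add: power2_eq_square algebra_simps)
  then show False using n(3) by (simp add: mult_le_0_iff)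
qed

end

section \<open>Exponential moments of the surplus\<close>

lemma cosh_ge_quadratic: "1 + z\<^sup>2 / 2 \<le> cosh (z :: real)"
proof -
  have "(\<Sum>n<3. if even n then z ^ n /\<^sub>R fact n else 0) \<le> cosh z"
    unfolding sums_unique[OF cosh_converges, of z]
    by (rule sum_le_suminf[OF sums_summable[OF cosh_converges]]) (auto simp: zero_le_even_power)
  then show ?thesis by (simp add: eval_nat_numeral)
qed

lemma exp_abs_le_cosh_add_cosh: "exp \<bar>a + b\<bar> \<le> cosh (2 * a) + cosh (2 * b :: real)"
proof -
  have *: "2 * exp (a + b) \<le> exp (2 * a) + exp (2 * b)" for a b :: real
    using sum_squares_bound[of "exp a" "exp b"] by (simp add: exp_add exp_double)
  have "2 * exp \<bar>a + b\<bar> \<le> (exp (2 * a) + exp (2 * b)) + (exp (- (2 * a)) + exp (- (2 * b)))"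
    using *[of a b] *[of "- a" "- b"] by (cases "a + b \<ge> 0") (auto intro: order_trans add_nonneg_nonneg simp: abs_if add_increasing add_increasing2)
  then show ?thesis by (simp add: cosh_field_def field_simps)
qed

lemma one_plus_signed_eq_exp:
  fixes x s :: real
  assumes x: "\<bar>x\<bar> < 1" and s: "s = 1 \<or> s = - 1"
  shows "1 + x * s = exp (ln (1 - x\<^sup>2) / 2 + s * (artanh x))"
proof -
  have x': "0 < 1 + x" "0 < 1 - x" using x by (auto simp: abs_less_iff)
  have "ln (1 - x\<^sup>2) = ln (1 + x) + ln (1 - x)"
    using ln_mult_pos[OF x'] by (simp add: power2_eq_square algebra_simps)
  then show ?thesis
    using s x' by (auto simp: artanh_def ln_div field_simps)
qed

lemma artanh_ge:
  fixes x :: real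
  assumes "0 \<le> x" "x < 1"
  shows "x \<le> artanh x"
proof -
  have "ln (1 + 0) - ln (1 - 0) - 2 * 0 \<le> ln (1 + x) - ln (1 - x) - 2 * x"
  proof (rule DERIV_nonneg_imp_nondecreasing[OF assms(1)])
    fix t assume t: "0 \<le> t" "t \<le> x"
    have "((\<lambda>t. ln (1 + t) - ln (1 - t) - 2 * t) has_real_derivative (1 / (1 + t) + 1 / (1 - t) - 2)) (at t)"
      using t assms by (auto intro!: derivative_eq_intros)
    moreover have "0 \<le> 1 / (1 + t) + 1 / (1 - t) - 2"
    proof -
      have "0 < 1 - t * t" using t assms mult_le_one[of t t] by (simp add: mult_less_cancel_left abs_square_less_1 flip: power2_eq_square)
      then have "2 \<le> 2 / (1 - t * t)" by (simp add: field_simps)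
      also have "\<dots> = 1 / (1 + t) + 1 / (1 - t)" using t assms by (simp add: field_simps)
      finally show ?thesis by simp
    qed
    ultimately show "\<exists>y. ((\<lambda>t. ln (1 + t) - ln (1 - t) - 2 * t) has_real_derivative y) (at t) \<and> 0 \<le> y" by blast
  qed
  then show ?thesis using assms by (simp add: artanh_def ln_div)
qed

lemma cosh_mono_abs:
  fixes a b :: real
  assumes "\<bar>a\<bar> \<le> \<bar>b\<bar>"
  shows "cosh a \<le> cosh b"
  using assms cosh_real_nonneg_le_iff[of "\<bar>a\<bar>" "\<bar>b\<bar>"] by simp

context tournament
begin

lemma order_weight_eq_exp:
  assumes x: "\<bar>x\<bar> < 1" and inj: "inj_on \<phi> (pverts T)"
  shows "order_weight (parcs T) x \<phi> =
    exp (real (card (parcs T)) * (ln (1 - x\<^sup>2) / 2) + artanh x * surplus (parcs T) \<phi>)"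
proof -
  have "order_weight (parcs T) x \<phi> =
     (\<Prod>(u, v)\<in>parcs T. exp (ln (1 - x\<^sup>2) / 2 + order_sign (\<phi> u) (\<phi> v) * (artanh x)))"
    unfolding order_weight_def
  proof (intro prod.cong refl, clarify)
    fix u v assume "(u, v) \<in> parcs T"
    then have "\<phi> u \<noteq> \<phi> v" using inj by (auto dest!: arcD simp: inj_on_def)
    then have "order_sign (\<phi> u) (\<phi> v) = 1 \<or> order_sign (\<phi> u) (\<phi> v) = - 1" by (auto simp: order_sign_def)
    from one_plus_signed_eq_exp[OF x this]
    show "1 + x * order_sign (\<phi> u) (\<phi> v) = exp (ln (1 - x\<^sup>2) / 2 + order_sign (\<phi> u) (\<phi> v) * (artanh x))" .
  qed
  also have "\<dots> = exp (\<Sum>(u, v)\<in>parcs T. ln (1 - x\<^sup>2) / 2 + order_sign (\<phi> u) (\<phi> v) * (artanh x))"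
    by (simp add: exp_sum case_prod_unfold)
  also have "(\<Sum>(u, v)\<in>parcs T. ln (1 - x\<^sup>2) / 2 + order_sign (\<phi> u) (\<phi> v) * (artanh x))
     = real (card (parcs T)) * (ln (1 - x\<^sup>2) / 2) + artanh x * surplus (parcs T) \<phi>"
    by (simp add: case_prod_unfold sum.distrib surplus_def sum_distrib_left mult.commute)
  finally show ?thesis .
qed

lemma inj_on_comp_permutes:
  assumes "inj_on \<phi> (pverts T)" "p permutes pverts T"
  shows "inj_on (\<phi> \<circ> p) (pverts T)"
  using assms by (auto intro!: comp_inj_on permutes_inj_on simp: permutes_image)

text \<open>
  The weight of an ordering is \<open>(1 - x\<^sup>2) powr (m / 2) * exp (artanh x * S)\<close> with \<open>m\<close> arcs and surplus
  \<open>S\<close>. Reversing the ordering changes the sign of \<open>S\<close>, so that the sum of the two weights is a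
  hyperbolic cosine.
\<close>

lemma sum_cosh_surplus_le:
  assumes non_transitive: "\<not> transitive_tournament T" and forcing: "locally_forcing T"
    and inj: "inj_on \<phi> (pverts T)" and x: "0 \<le> x" "x\<^sup>2 \<le> 1/2"
  shows "(\<Sum>p | p permutes pverts T. cosh (x * surplus (parcs T) (\<phi> \<circ> p)))
     \<le> fact (card (pverts T)) * exp (real (card (parcs T)) / 2 * (x\<^sup>2 + 2 * x ^ 4))"
proof -
  define m where "m = real (card (parcs T))"
  define M where "M = Max (\<phi> ` pverts T)"
  \<comment> \<open>the reversed ordering\<close>
  define \<phi>' where "\<phi>' v = M - \<phi> v" for v
  let ?P = "{p. p permutes pverts T}"
  have le_M: "\<phi> v \<le> M" if "v \<in> pverts T" for v unfolding M_def using that by simp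
  have sign': "order_sign (\<phi>' u) (\<phi>' v) = - order_sign (\<phi> u) (\<phi> v)" if "u \<in> pverts T" "v \<in> pverts T" for u v
    using le_M[OF that(1)] le_M[OF that(2)] by (auto simp: \<phi>'_def order_sign_def)
  have inj': "inj_on \<phi>' (pverts T)"
    using inj le_M by (auto simp: inj_on_def \<phi>'_def) (metis diff_diff_cancel)
  have x1: "x < 1"
  proof (rule ccontr)
    assume "\<not> x < 1"
    then have "1 \<le> x\<^sup>2" by (simp add: one_le_power)
    then show False using x by simp
  qed
  define l where "l = artanh x"
  have surplus': "surplus (parcs T) (\<phi>' \<circ> p) = - surplus (parcs T) (\<phi> \<circ> p)" if "p permutes pverts T" for p
    unfolding surplus_def sum_negf[symmetric]
    by (intro sum.cong refl) (use that in \<open>auto dest!: arcD simp: sign' permutes_in_image\<close>)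
  have weights: "order_weight (parcs T) x (\<phi> \<circ> p) + order_weight (parcs T) x (\<phi>' \<circ> p)
      = 2 * exp (m * (ln (1 - x\<^sup>2) / 2)) * cosh (l * surplus (parcs T) (\<phi> \<circ> p))" if "p permutes pverts T" for p
  proof -
    have "\<bar>x\<bar> < 1" using x x1 by simp
    then have "order_weight (parcs T) x (\<phi> \<circ> p) = exp (m * (ln (1 - x\<^sup>2) / 2) + l * surplus (parcs T) (\<phi> \<circ> p))"
      "order_weight (parcs T) x (\<phi>' \<circ> p) = exp (m * (ln (1 - x\<^sup>2) / 2) + l * - surplus (parcs T) (\<phi> \<circ> p))"
      unfolding m_def l_def surplus'[OF that, symmetric]
      by (rule order_weight_eq_exp[OF _ inj_on_comp_permutes[OF inj that]],
          rule order_weight_eq_exp[OF _ inj_on_comp_permutes[OF inj' that]])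
    moreover have "exp (M + a) + exp (M + - a) = 2 * exp M * cosh a" for M a :: real
      by (simp add: cosh_field_def exp_add exp_diff exp_minus field_simps)
    ultimately show ?thesis by (simp only: mult_minus_right)
  qed
  have "(\<Sum>p\<in>?P. cosh (x * surplus (parcs T) (\<phi> \<circ> p))) * (2 * exp (m * (ln (1 - x\<^sup>2) / 2)))
     \<le> (\<Sum>p\<in>?P. order_weight (parcs T) x (\<phi> \<circ> p) + order_weight (parcs T) x (\<phi>' \<circ> p))"
    unfolding sum_distrib_right
  proof (rule sum_mono)
    fix p assume p: "p \<in> ?P"
    have "\<bar>x\<bar> \<le> \<bar>l\<bar>" using artanh_ge[OF x(1) x1] x(1) by (simp add: l_def)
    then have "cosh (x * surplus (parcs T) (\<phi> \<circ> p)) \<le> cosh (l * surplus (parcs T) (\<phi> \<circ> p))"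
      by (intro cosh_mono_abs) (auto simp: abs_mult intro: mult_right_mono)
    then show "cosh (x * surplus (parcs T) (\<phi> \<circ> p)) * (2 * exp (m * (ln (1 - x\<^sup>2) / 2)))
        \<le> order_weight (parcs T) x (\<phi> \<circ> p) + order_weight (parcs T) x (\<phi>' \<circ> p)"
      using weights p by (simp add: mult.commute)
  qed
  also have "\<dots> \<le> 2 * fact (card (pverts T))"
    using sum_order_weight_le_fact[OF non_transitive forcing inj x(1) x1]
      sum_order_weight_le_fact[OF non_transitive forcing inj' x(1) x1]
    by (simp add: sum.distrib)
  finally have "(\<Sum>p\<in>?P. cosh (x * surplus (parcs T) (\<phi> \<circ> p))) * exp (m * (ln (1 - x\<^sup>2) / 2)) \<le> fact (card (pverts T))"
    by simp
  then have "(\<Sum>p\<in>?P. cosh (x * surplus (parcs T) (\<phi> \<circ> p))) \<le> fact (card (pverts T)) * exp (- (m * (ln (1 - x\<^sup>2) / 2)))"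
    by (simp add: exp_minus field_simps)
  also have "\<dots> \<le> fact (card (pverts T)) * exp (m / 2 * (x\<^sup>2 + 2 * x ^ 4))"
  proof -
    have "- x\<^sup>2 - 2 * (x\<^sup>2)\<^sup>2 \<le> ln (1 - x\<^sup>2)"
      using x by (intro ln_one_minus_pos_lower_bound) auto
    then have "m / 2 * (- ln (1 - x\<^sup>2)) \<le> m / 2 * (x\<^sup>2 + 2 * x ^ 4)"
      by (intro mult_left_mono) (auto simp: m_def)
    then show ?thesis by simp
  qed
  finally show ?thesis by (simp add: m_def)
qed

end

section \<open>The second moment of the surplus\<close>

context tournament
begin

text \<open>
  Exchanging the ends of one pair shows that the signs of two disjoint pairs are uncorrelated. For
  pairs with a common vertex one uses that of three different numbers exactly one lies between the
  others: the products of signs taken at the three numbers are 1, 1 and -1 in some order, and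
  by symmetry each of them has mean \<open>1/3\<close>.
\<close>

lemma sign_correlation:
  fixes \<phi> :: "'a \<Rightarrow> nat"
  assumes inj: "inj_on \<phi> (pverts T)"
    and V: "u \<in> pverts T" "v \<in> pverts T" "w \<in> pverts T" "z \<in> pverts T" and ne: "u \<noteq> v" "w \<noteq> z"
  shows "(\<Sum>p | p permutes pverts T. order_sign (\<phi> (p u)) (\<phi> (p v)) * order_sign (\<phi> (p w)) (\<phi> (p z)))
    = fact (card (pverts T)) / 3 * (of_bool (u = w) + of_bool (v = z) - of_bool (u = z) - of_bool (v = w)
        + of_bool (u = w \<and> v = z) - of_bool (u = z \<and> v = w))"
proof -
  define B where "B u v w z = (\<Sum>p | p permutes pverts T. order_sign (\<phi> (p u)) (\<phi> (p v)) * order_sign (\<phi> (p w)) (\<phi> (p z)))"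
    for u v w z
  let ?f = "fact (card (pverts T)) :: real"
  have swap1: "B v u w z = - B u v w z" and swap2: "B u v z w = - B u v w z" for u v w z
    unfolding B_def sum_negf[symmetric]
    by (intro sum.cong refl, metis order_sign_swap mult_minus_left mult_minus_right)+
  have comm: "B w z u v = B u v w z" for u v w z
    by (simp add: B_def mult.commute)
  have perm: "B (q u) (q v) (q w) (q z) = B u v w z" if "q permutes pverts T" for q u v w z
    using sum_permutations_compose_right[OF that, of "\<lambda>p. order_sign (\<phi> (p u)) (\<phi> (p v)) * order_sign (\<phi> (p w)) (\<phi> (p z))"]
    by (simp add: B_def)
  have inj_p: "\<phi> (p a) \<noteq> \<phi> (p b)" if "p permutes pverts T" "a \<in> pverts T" "b \<in> pverts T" "a \<noteq> b" for p a b
    using inj_on_comp_permutes[OF inj that(1)] that by (auto simp: inj_on_def)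
  have same: "B a b a b = ?f" if "a \<in> pverts T" "b \<in> pverts T" "a \<noteq> b" for a b
  proof -
    have "B a b a b = (\<Sum>p | p permutes pverts T. 1)"
      unfolding B_def by (intro sum.cong refl) (use that inj_p in \<open>auto simp: order_sign_def\<close>)
    then show ?thesis by (simp add: card_permutations)
  qed
  have share: "B a b a c = ?f / 3" if abc: "a \<in> pverts T" "b \<in> pverts T" "c \<in> pverts T" "a \<noteq> b" "a \<noteq> c" "b \<noteq> c" for a b c
  proof -
    have "B a b a c + B b a b c + B c a c b = (\<Sum>p | p permutes pverts T. 1)"
      unfolding B_def sum.distrib[symmetric]
    proof (intro sum.cong refl)
      fix p assume "p \<in> {p. p permutes pverts T}"
      then have "\<phi> (p a) \<noteq> \<phi> (p b)" "\<phi> (p a) \<noteq> \<phi> (p c)" "\<phi> (p b) \<noteq> \<phi> (p c)" using inj_p abc by auto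
      then show "order_sign (\<phi> (p a)) (\<phi> (p b)) * order_sign (\<phi> (p a)) (\<phi> (p c)) +
         order_sign (\<phi> (p b)) (\<phi> (p a)) * order_sign (\<phi> (p b)) (\<phi> (p c)) +
         order_sign (\<phi> (p c)) (\<phi> (p a)) * order_sign (\<phi> (p c)) (\<phi> (p b)) = 1"
        unfolding order_sign_def
        by (cases "\<phi> (p a)" "\<phi> (p b)" rule: linorder_cases; cases "\<phi> (p a)" "\<phi> (p c)" rule: linorder_cases;
            cases "\<phi> (p b)" "\<phi> (p c)" rule: linorder_cases) simp_all
    qed
    moreover have "B b a b c = B a b a c"
      using perm[OF permutes_swap_id[OF abc(1,2)], of a b a c] abc by simp
    moreover have "B c b c a = B a b a c"
      using perm[OF permutes_swap_id[OF abc(1,3)], of a b a c] abc by simp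
    ultimately show ?thesis using comm[of c b c a] by (simp add: card_permutations)
  qed
  have disjoint: "B a b c d = 0" if "a \<in> pverts T" "b \<in> pverts T" "c \<noteq> a" "c \<noteq> b" "d \<noteq> a" "d \<noteq> b" for a b c d
    using perm[OF permutes_swap_id[OF that(1,2)], of a b c d] swap1[of b a c d] that by (simp add: transpose_apply_other)
  consider "u \<noteq> w" "u \<noteq> z" "v \<noteq> w" "v \<noteq> z" | "u = w" "v = z" | "u = z" "v = w"
    | "u = w" "v \<noteq> z" | "u = z" "v \<noteq> w" | "v = w" "u \<noteq> z" | "v = z" "u \<noteq> w" by blast
  then have "B u v w z = ?f / 3 * (of_bool (u = w) + of_bool (v = z) - of_bool (u = z) - of_bool (v = w)
        + of_bool (u = w \<and> v = z) - of_bool (u = z \<and> v = w))"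
  proof cases
    case 1
    then show ?thesis using disjoint[of u v w z] V by simp
  next
    case 2
    then show ?thesis using same[of u v] V ne by simp
  next
    case 3
    then show ?thesis using same[of u v] swap2[of u v v u] V ne by simp
  next
    case 4
    then show ?thesis using share[of u v z] V ne by simp
  next
    case 5
    then show ?thesis using share[of u v w] swap2[of u v w u] V ne by simp
  next
    case 6
    then show ?thesis using share[of v u z] swap1[of v u v z] V ne by simp
  next
    case 7
    then show ?thesis using share[of v u w] swap1[of v u w v] swap2[of v u w v] V ne by simp
  qed  then show ?thesis by (simp only: B_def)
qed

text \<open>
  For a fixed arc \<open>(u, v)\<close> the correlations with all arcs add up to \<open>(D u - D v + 1) / 3\<close>, and summing
  \<open>D u - D v\<close> over the arcs gives the sum of the squares of \<open>D\<close>.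
\<close>

lemma sum_surplus_squared:
  fixes \<phi> :: "'a \<Rightarrow> nat"
  assumes inj: "inj_on \<phi> (pverts T)"
  defines "D \<equiv> \<lambda>v. real (card {e \<in> parcs T. fst e = v}) - real (card {e \<in> parcs T. snd e = v})"
  shows "(\<Sum>p | p permutes pverts T. (surplus (parcs T) (\<phi> \<circ> p))\<^sup>2)
     = fact (card (pverts T)) / 3 * (real (card (parcs T)) + (\<Sum>v\<in>pverts T. (D v)\<^sup>2))"
proof -
  let ?E = "parcs T" and ?f = "fact (card (pverts T)) / 3 :: real"
  define outd ind where "outd v = real (card {e \<in> ?E. fst e = v})" and "ind v = real (card {e \<in> ?E. snd e = v})" for v
  have D: "D v = outd v - ind v" for v by (simp add: D_def outd_def ind_def)
  have fst_V: "fst ` ?E \<subseteq> pverts T" and snd_V: "snd ` ?E \<subseteq> pverts T"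
    by (auto dest: arcD)
  have outd': "outd v = real (card {e \<in> ?E. v = fst e})" and ind': "ind v = real (card {e \<in> ?E. v = snd e})" for v
    by (auto simp: outd_def ind_def intro!: arg_cong[of _ _ card])
  have count: "(\<Sum>e\<in>?E. of_bool (Q e)) = real (card {e \<in> ?E. Q e})" for Q
    by (simp add: Int_def)
  have "(\<Sum>p | p permutes pverts T. (surplus ?E (\<phi> \<circ> p))\<^sup>2)
      = (\<Sum>p | p permutes pverts T. \<Sum>e\<in>?E. \<Sum>e'\<in>?E. order_sign (\<phi> (p (fst e))) (\<phi> (p (snd e))) * order_sign (\<phi> (p (fst e'))) (\<phi> (p (snd e'))))"
    by (simp add: surplus_def power2_eq_square sum_product case_prod_unfold)
  also have "\<dots> = (\<Sum>e\<in>?E. \<Sum>e'\<in>?E. \<Sum>p | p permutes pverts T. order_sign (\<phi> (p (fst e))) (\<phi> (p (snd e))) * order_sign (\<phi> (p (fst e'))) (\<phi> (p (snd e'))))"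
    by (subst sum.swap, intro sum.cong refl, subst sum.swap, rule refl)
  also have "\<dots> = (\<Sum>e\<in>?E. ?f * (D (fst e) - D (snd e) + 1))"
  proof (intro sum.cong refl)
    fix e assume e: "e \<in> ?E"
    have "(\<Sum>e'\<in>?E. \<Sum>p | p permutes pverts T. order_sign (\<phi> (p (fst e))) (\<phi> (p (snd e))) * order_sign (\<phi> (p (fst e'))) (\<phi> (p (snd e'))))
      = (\<Sum>e'\<in>?E. ?f * (of_bool (fst e = fst e') + of_bool (snd e = snd e') - of_bool (fst e = snd e') - of_bool (snd e = fst e') + of_bool (fst e = fst e' \<and> snd e = snd e')))"
    proof (intro sum.cong refl)
      fix e' assume e': "e' \<in> ?E"
      have "\<not> (fst e = snd e' \<and> snd e = fst e')"
        using arcD[of "fst e" "snd e"] e e' by auto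
      then show "(\<Sum>p | p permutes pverts T. order_sign (\<phi> (p (fst e))) (\<phi> (p (snd e))) * order_sign (\<phi> (p (fst e'))) (\<phi> (p (snd e'))))
          = ?f * (of_bool (fst e = fst e') + of_bool (snd e = snd e') - of_bool (fst e = snd e') - of_bool (snd e = fst e') + of_bool (fst e = fst e' \<and> snd e = snd e'))"
        using sign_correlation[OF inj, of "fst e" "snd e" "fst e'" "snd e'"] arcD[of "fst e" "snd e"] arcD[of "fst e'" "snd e'"] e e'
        by simp
    qed
    also have "\<dots> = ?f * (outd (fst e) + ind (snd e) - ind (fst e) - outd (snd e) + real (card {e' \<in> ?E. fst e = fst e' \<and> snd e = snd e'}))"
      unfolding sum_distrib_left[symmetric] sum.distrib sum_subtractf count outd' ind' ..
    also have "{e' \<in> ?E. fst e = fst e' \<and> snd e = snd e'} = {e}" using e by (auto simp: prod_eq_iff)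
    finally show "(\<Sum>e'\<in>?E. \<Sum>p | p permutes pverts T. order_sign (\<phi> (p (fst e))) (\<phi> (p (snd e))) * order_sign (\<phi> (p (fst e'))) (\<phi> (p (snd e'))))
       = ?f * (D (fst e) - D (snd e) + 1)"
      by (simp add: D algebra_simps)
  qed
  also have "\<dots> = ?f * ((\<Sum>e\<in>?E. D (fst e)) - (\<Sum>e\<in>?E. D (snd e)) + real (card ?E))"
    by (simp only: sum_distrib_left[symmetric] sum.distrib sum_subtractf sum_constant mult_1_right)
  also have "(\<Sum>e\<in>?E. D (fst e)) = (\<Sum>v\<in>pverts T. outd v * D v)"
    using sum.group[of ?E "pverts T" fst "\<lambda>e. D (fst e)"] fst_V by (simp add: outd_def)
  also have "(\<Sum>e\<in>?E. D (snd e)) = (\<Sum>v\<in>pverts T. ind v * D v)"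
    using sum.group[of ?E "pverts T" snd "\<lambda>e. D (snd e)"] snd_V by (simp add: ind_def)
  also have "(\<Sum>v\<in>pverts T. outd v * D v) - (\<Sum>v\<in>pverts T. ind v * D v) = (\<Sum>v\<in>pverts T. (D v)\<^sup>2)"
    by (simp add: sum_subtractf[symmetric] D power2_eq_square algebra_simps)
  finally show ?thesis by (simp only: add.commute)
qed

text \<open>
  This compares the coefficients of \<open>x\<^sup>2\<close> in \<open>sum_cosh_surplus_le\<close> as \<open>x\<close> tends to 0.
\<close>

lemma sum_surplus_squared_le:
  assumes non_transitive: "\<not> transitive_tournament T" and forcing: "locally_forcing T"
    and inj: "inj_on \<phi> (pverts T)"
  shows "(\<Sum>p | p permutes pverts T. (surplus (parcs T) (\<phi> \<circ> p))\<^sup>2) \<le> fact (card (pverts T)) * real (card (parcs T))"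
proof (rule ccontr)
  define m where "m = real (card (parcs T))"
  define M where "M = (\<Sum>p | p permutes pverts T. (surplus (parcs T) (\<phi> \<circ> p))\<^sup>2) / fact (card (pverts T))"
  have m: "0 \<le> m" by (simp add: m_def)
  assume "\<not> ?thesis"
  then have "m < M" by (simp add: M_def m_def field_simps)
  \<comment> \<open>the value of \<open>x\<^sup>2\<close>; the first term keeps the exponent \<open>w\<close> below 1, the second makes the
    terms of order \<open>y\<^sup>2\<close> smaller than \<open>(M - m) * y\<close>\<close>
  define y where "y = min (1 / (2 * (m + 1))) ((M - m) / (4 * (m + m\<^sup>2 + 1)))"
  have pos: "0 < 4 * (m + m\<^sup>2 + 1)" using m by (intro mult_pos_pos add_nonneg_pos add_nonneg_nonneg) auto
  have y: "0 < y" using m \<open>m < M\<close> pos by (auto simp: y_def)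
  have "y \<le> 1 / (2 * (m + 1))" by (simp add: y_def)
  then have my: "2 * (m * y) + 2 * y \<le> 1" using m by (simp add: field_simps)
  have "0 \<le> m * y" using m y by simp
  then have y_half: "y \<le> 1/2" "m * y \<le> 1/2" using my y by linarith+
  have "y \<le> (M - m) / (4 * (m + m\<^sup>2 + 1))" by (simp add: y_def)
  then have yM: "4 * (m + m\<^sup>2 + 1) * y \<le> M - m" using pos by (simp add: pos_le_divide_eq mult.commute)
  define w where "w = m / 2 * (y + 2 * y\<^sup>2)"
  have "y * y \<le> 1/2 * y" using y_half(1) y by (intro mult_right_mono) auto
  then have "m / 2 * (y + 2 * y\<^sup>2) \<le> m / 2 * (2 * y)" using m by (intro mult_left_mono) (auto simp: power2_eq_square)
  then have w: "0 \<le> w" "w \<le> m * y" using m y by (auto simp: w_def)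
  have "1 + y / 2 * M = (\<Sum>p | p permutes pverts T. 1 + (sqrt y * surplus (parcs T) (\<phi> \<circ> p))\<^sup>2 / 2) / fact (card (pverts T))"
    using y by (simp add: M_def sum.distrib power_mult_distrib card_permutations sum_divide_distrib[symmetric] sum_distrib_left[symmetric] add_divide_distrib)
  also have "\<dots> \<le> (\<Sum>p | p permutes pverts T. cosh (sqrt y * surplus (parcs T) (\<phi> \<circ> p))) / fact (card (pverts T))"
    by (intro divide_right_mono sum_mono cosh_ge_quadratic) simp
  also have "\<dots> \<le> exp w"
  proof -
    have "sqrt y ^ 4 = y\<^sup>2" using y by (metis less_imp_le numeral_times_numeral power_mult real_sqrt_pow2 semiring_norm(12) semiring_norm(13))
    then show ?thesis
      using sum_cosh_surplus_le[OF non_transitive forcing inj, of "sqrt y"] y y_half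
      by (simp add: w_def m_def field_simps)
  qed
  also have "\<dots> \<le> 1 + w + w\<^sup>2"
    using w y_half by (intro exp_bound) auto
  also have "w\<^sup>2 \<le> (m * y)\<^sup>2" using w by (intro power_mono)
  finally have "y / 2 * M \<le> y / 2 * (m + 2 * (m * y) + 2 * (m\<^sup>2 * y))"
    by (simp add: w_def power_mult_distrib power2_eq_square algebra_simps)
  then have "M \<le> m + 2 * (m * y) + 2 * (m\<^sup>2 * y)" using y by simp
  moreover have "0 \<le> m\<^sup>2 * y" using y by simp
  moreover have "4 * (m * y) + 4 * (m\<^sup>2 * y) + 4 * y \<le> M - m" using yM by (simp add: algebra_simps)
  ultimately show False using \<open>0 \<le> m * y\<close> y by linarith
qed

lemma sum_degree_difference_squared_le:
  assumes non_transitive: "\<not> transitive_tournament T" and forcing: "locally_forcing T"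
  shows "(\<Sum>v\<in>pverts T. (int (out_degree (with_proj T) v) - int (in_degree (with_proj T) v))\<^sup>2)
           \<le> int (card (pverts T)) * (int (card (pverts T)) - 1)"
proof -
  let ?h = "card (pverts T)"
  obtain \<phi> :: "'a \<Rightarrow> nat" where inj: "inj_on \<phi> (pverts T)"
    using finite_imp_inj_to_nat_seg[OF finite_V] by blast
  define D where "D v = real (card {e \<in> parcs T. fst e = v}) - real (card {e \<in> parcs T. snd e = v})" for v
  have "fact ?h / 3 * (real (card (parcs T)) + (\<Sum>v\<in>pverts T. (D v)\<^sup>2)) \<le> fact ?h * real (card (parcs T))"
    using sum_surplus_squared_le[OF non_transitive forcing inj] unfolding sum_surplus_squared[OF inj] D_def .
  then have "fact ?h * (real (card (parcs T)) + (\<Sum>v\<in>pverts T. (D v)\<^sup>2)) \<le> fact ?h * (3 * real (card (parcs T)))" by simp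
  then have "(\<Sum>v\<in>pverts T. (D v)\<^sup>2) \<le> 2 * real (card (parcs T))" by (simp only: mult_le_cancel_left_pos fact_gt_zero)
  also have "\<dots> = real ?h * (real ?h - 1)" by (simp add: card_arcs real_choose_two)
  finally have "real_of_int (\<Sum>v\<in>pverts T. (int (out_degree (with_proj T) v) - int (in_degree (with_proj T) v))\<^sup>2)
     \<le> real_of_int (int ?h * (int ?h - 1))"
    by (simp add: D_def out_degree_def in_degree_def out_arcs_def in_arcs_def)
  then show ?thesis by (simp only: of_int_le_iff)
qed

end

section \<open>Labellings of the vertices\<close>

context tournament
begin

text \<open>
  Let the vertices be ordered by label and within a label by \<open>f\<close>, or within a label by the reverse of
  \<open>f\<close>. The arcs within labels cancel in the sum of the two surpluses, so that one of the two orderings has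
  a surplus at least as large in absolute value as that of \<open>c\<close>. To see how much such orderings
  contribute to an exponential moment, refine each of the \<open>k ^ h\<close> labellings \<open>e\<close> to an ordering \<open>\<phi> s e\<close> in
  both ways. For each of them \<open>sum_cosh_surplus_le\<close> bounds the sum over all \<open>\<phi> s e \<circ> p\<close>; and for
  every \<open>p\<close> there is an \<open>e\<close> for which \<open>\<phi> s e \<circ> p\<close> sorts by the labels \<open>c\<close>.
\<close>

lemma exp_label_surplus_le:
  assumes non_transitive: "\<not> transitive_tournament T" and forcing: "locally_forcing T"
    and K: "finite K" and c: "\<And>v. v \<in> pverts T \<Longrightarrow> c v \<in> K" and x: "0 \<le> x" "x\<^sup>2 \<le> 1/2"
  shows "exp (x * \<bar>surplus (parcs T) c\<bar>)
     \<le> 2 * real (card K) ^ card (pverts T) * exp (real (card (parcs T)) * x\<^sup>2)"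
proof -
  define h where "h = card (pverts T)"
  define B where "B = exp (real (card (parcs T)) / 2 * (x\<^sup>2 + 2 * x ^ 4))"
  let ?P = "{p. p permutes pverts T}" and ?L = "pverts T \<rightarrow>\<^sub>E K"
  obtain f where f: "bij_betw f (pverts T) {0..<h}"
    using ex_bij_betw_finite_nat[OF finite_V] unfolding h_def by blast
  have f_less: "f v < h" if "v \<in> pverts T" for v using bij_betwE[OF f] that by simp
  define g where "g s v = (if s then f v else h - 1 - f v)" for s :: bool and v
  have g_less: "g s v < h" if "v \<in> pverts T" for s v using f_less[OF that] by (auto simp: g_def)
  have g_inj: "inj_on (g s) (pverts T)" for s
  proof (rule inj_onI)
    fix u v assume "u \<in> pverts T" "v \<in> pverts T" "g s u = g s v"
    then have "f u = f v" using f_less[of u] f_less[of v] by (auto simp: g_def split: if_splits)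
    then show "u = v" using f \<open>u \<in> pverts T\<close> \<open>v \<in> pverts T\<close> by (auto simp: bij_betw_def dest: inj_onD)
  qed
  define \<phi> where "\<phi> s d v = d v * h + g s v" for s and d :: "'a \<Rightarrow> nat" and v
  have \<phi>_inj: "inj_on (\<phi> s d) (pverts T)" for s d
  proof (rule inj_onI)
    fix u v assume uv: "u \<in> pverts T" "v \<in> pverts T" "\<phi> s d u = \<phi> s d v"
    then have "(d u * h + g s u) mod h = (d v * h + g s v) mod h" by (simp add: \<phi>_def)
    then have "g s u = g s v" using g_less uv by simp
    then show "u = v" using g_inj uv by (meson inj_onD)
  qed
  \<comment> \<open>the labelling that \<open>p\<close> carries to \<open>c\<close>\<close>
  define d where "d p = restrict (c \<circ> inv p) (pverts T)" for p
  have d_mem: "d p \<in> ?L" if "p permutes pverts T" for p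
    using c permutes_inv[OF that] by (auto simp: d_def permutes_in_image)
  have \<phi>_d: "(\<phi> s (d p) \<circ> p) v = c v * h + g s (p v)" if "p permutes pverts T" "v \<in> pverts T" for s p v
    using that by (simp add: \<phi>_def d_def permutes_in_image permutes_inverses)
  have sum_surplus: "surplus (parcs T) (\<phi> True (d p) \<circ> p) + surplus (parcs T) (\<phi> False (d p) \<circ> p) = 2 * surplus (parcs T) c"
    if p: "p permutes pverts T" for p
    unfolding surplus_def sum_distrib_left sum.distrib[symmetric]
  proof (intro sum.cong refl, clarify)
    fix u v assume "(u, v) \<in> parcs T"
    then have V: "u \<in> pverts T" "v \<in> pverts T" by (auto dest: arcD)
    have less: "f (p u) < h" "f (p v) < h" using V p f_less by (simp_all add: permutes_in_image)
    have lex: "a * h + i < b * h + j" if "a < b" "i < h" for a b i j :: nat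
    proof -
      have "a * h + i < Suc a * h" using that by simp
      also have "\<dots> \<le> b * h" using that by (intro mult_right_mono) auto
      finally show ?thesis by simp
    qed
    show "order_sign ((\<phi> True (d p) \<circ> p) u) ((\<phi> True (d p) \<circ> p) v) +
       order_sign ((\<phi> False (d p) \<circ> p) u) ((\<phi> False (d p) \<circ> p) v) = 2 * order_sign (c u) (c v)"
      unfolding \<phi>_d[OF p V(1)] \<phi>_d[OF p V(2)]
    proof (cases "c u" "c v" rule: linorder_cases)
      case less
      then have "c u * h + g s (p u) < c v * h + g s (p v)" for s
        by (rule lex) (use g_less V p in \<open>simp add: permutes_in_image\<close>)
      then show "order_sign (c u * h + g True (p u)) (c v * h + g True (p v)) +
        order_sign (c u * h + g False (p u)) (c v * h + g False (p v)) = 2 * order_sign (c u) (c v)"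
        using less by (simp add: order_sign_def)
    next
      case greater
      then have *: "c v * h + g s (p v) < c u * h + g s (p u)" for s
        by (rule lex) (use g_less V p in \<open>simp add: permutes_in_image\<close>)
      show "order_sign (c u * h + g True (p u)) (c v * h + g True (p v)) +
        order_sign (c u * h + g False (p u)) (c v * h + g False (p v)) = 2 * order_sign (c u) (c v)"
        using greater *[of True] *[of False] by (simp add: order_sign_def)
    next
      case equal
      then show "order_sign (c u * h + g True (p u)) (c v * h + g True (p v)) +
        order_sign (c u * h + g False (p u)) (c v * h + g False (p v)) = 2 * order_sign (c u) (c v)"
        using less by (auto simp: order_sign_def g_def)
    qed
  qed
  define S where "S s d p = cosh (x * surplus (parcs T) (\<phi> s d \<circ> p))" for s d p
  have "fact h * exp (x * \<bar>surplus (parcs T) c\<bar>) = (\<Sum>p\<in>?P. exp (x * \<bar>surplus (parcs T) c\<bar>))"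
    by (simp add: card_permutations h_def)
  also have "\<dots> \<le> (\<Sum>p\<in>?P. S True (d p) p + S False (d p) p)"
  proof (rule sum_mono)
    fix p assume p: "p \<in> ?P"
    let ?a = "surplus (parcs T) (\<phi> True (d p) \<circ> p)" and ?b = "surplus (parcs T) (\<phi> False (d p) \<circ> p)"
    have "?a + ?b = 2 * surplus (parcs T) c" using sum_surplus p by simp
    then have "x * ?a / 2 + x * ?b / 2 = x * surplus (parcs T) c"
      by (simp add: add_divide_distrib[symmetric] distrib_left[symmetric])
    then have "x * \<bar>surplus (parcs T) c\<bar> = \<bar>x * ?a / 2 + x * ?b / 2\<bar>"
      using x by (simp add: abs_mult)
    then show "exp (x * \<bar>surplus (parcs T) c\<bar>) \<le> S True (d p) p + S False (d p) p"
      using exp_abs_le_cosh_add_cosh[of "x * ?a / 2" "x * ?b / 2"] by (simp add: S_def)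
  qed
  also have "\<dots> \<le> (\<Sum>p\<in>?P. \<Sum>e\<in>?L. S True e p + S False e p)"
  proof (rule sum_mono)
    fix p assume "p \<in> ?P"
    then show "S True (d p) p + S False (d p) p \<le> (\<Sum>e\<in>?L. S True e p + S False e p)"
      using member_le_sum[of "d p" ?L "\<lambda>e. S True e p + S False e p"] d_mem K
      by (simp add: S_def finite_PiE)
  qed
  also have "\<dots> = (\<Sum>e\<in>?L. (\<Sum>p\<in>?P. S True e p) + (\<Sum>p\<in>?P. S False e p))"
    by (subst sum.swap) (simp add: sum.distrib)
  also have "\<dots> \<le> (\<Sum>e\<in>?L. fact h * B + fact h * B)"
    unfolding S_def h_def B_def
    by (intro sum_mono add_mono sum_cosh_surplus_le non_transitive forcing \<phi>_inj x)
  also have "\<dots> = fact h * (2 * real (card K) ^ h * B)"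
    using K by (simp add: card_funcsetE h_def)
  finally have "exp (x * \<bar>surplus (parcs T) c\<bar>) \<le> 2 * real (card K) ^ h * B" by simp
  also have "\<dots> \<le> 2 * real (card K) ^ h * exp (real (card (parcs T)) * x\<^sup>2)"
  proof (rule mult_left_mono)
    have "x ^ 4 = x\<^sup>2 * x\<^sup>2" by (simp flip: power_add)
    also have "\<dots> \<le> 1/2 * x\<^sup>2" using x by (intro mult_right_mono) auto
    finally have "real (card (parcs T)) / 2 * (x\<^sup>2 + 2 * x ^ 4) \<le> real (card (parcs T)) / 2 * (2 * x\<^sup>2)"
      by (intro mult_left_mono) auto
    then show "B \<le> exp (real (card (parcs T)) * x\<^sup>2)" by (simp add: B_def)
  qed simp
  finally show ?thesis by (simp add: h_def)
qed

lemma label_surplus_le: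
  assumes non_transitive: "\<not> transitive_tournament T" and forcing: "locally_forcing T"
    and K: "finite K" "K \<noteq> {}" and c: "\<And>v. v \<in> pverts T \<Longrightarrow> c v \<in> K" and x: "0 \<le> x" "x\<^sup>2 \<le> 1/2"
  defines "h \<equiv> card (pverts T)"
  shows "x * \<bar>surplus (parcs T) c\<bar> \<le> ln 2 + real h * ln (real (card K)) + real h * (real h - 1) / 2 * x\<^sup>2"
proof -
  have k: "0 < real (card K)" using K by (simp add: card_gt_0_iff)
  have "x * \<bar>surplus (parcs T) c\<bar> \<le> ln (2 * real (card K) ^ h * exp (real (card (parcs T)) * x\<^sup>2))"
    using exp_label_surplus_le[OF non_transitive forcing K(1) c x] k
    by (subst ln_ge_iff) (auto simp: h_def)
  also have "\<dots> = ln 2 + real h * ln (real (card K)) + real (card (parcs T)) * x\<^sup>2"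
    using k by (simp add: ln_mult ln_realpow)
  finally show ?thesis by (simp add: card_arcs real_choose_two h_def)
qed

lemma two_le_card_if_not_transitive:
  assumes "\<not> transitive_tournament T"
  shows "2 \<le> card (pverts T)"
proof (rule ccontr)
  assume "\<not> 2 \<le> card (pverts T)"
  then have "card (parcs T) = 0" by (simp add: card_arcs binomial_eq_0)
  then have "parcs T = {}" by simp
  moreover obtain \<phi> :: "'a \<Rightarrow> nat" where inj: "inj_on \<phi> (pverts T)"
    using finite_imp_inj_to_nat_seg[OF finite_V] by blast
  ultimately show False using transitive_tournamentI[OF inj] assms by simp
qed

lemma surplus_eq_forward_arcs:
  assumes "inj_on \<sigma> (pverts T)"
  shows "surplus (parcs T) \<sigma> = 2 * real (card (forward_arcs \<sigma> T)) - real (card (pverts T) choose 2)"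
proof -
  have "surplus (parcs T) \<sigma> = (\<Sum>(u, v)\<in>parcs T. 2 * of_bool (\<sigma> u < \<sigma> v) - 1)"
    unfolding surplus_def
    by (intro sum.cong refl) (use assms in \<open>auto dest!: arcD simp: order_sign_def inj_on_def\<close>)
  also have "\<dots> = 2 * real (card (forward_arcs \<sigma> T)) - real (card (parcs T))"
    by (simp add: case_prod_unfold sum_subtractf sum_distrib_left[symmetric] forward_arcs_def Int_def)
  finally show ?thesis by (simp add: card_arcs)
qed

lemma forward_arcs_deviation_le:
  assumes non_transitive: "\<not> transitive_tournament T" and forcing: "locally_forcing T" and \<sigma>: "is_ordering \<sigma> T"
  defines "h \<equiv> card (pverts T)"
  shows "\<bar>real (card (forward_arcs \<sigma> T)) - 1/2 * real (h choose 2)\<bar> \<le> real h powr (3/2) * sqrt (ln (real h))"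
proof -
  have h: "2 \<le> real h" using two_le_card_if_not_transitive[OF non_transitive] by (simp add: h_def)
  have \<sigma>': "inj_on \<sigma> (pverts T)" "\<And>v. v \<in> pverts T \<Longrightarrow> \<sigma> v \<in> {1..h}"
    using \<sigma> by (auto simp: is_ordering_def bij_betw_def h_def)
  define x where "x = sqrt (ln (real h) / real h)"
  have ln_h: "ln 2 \<le> ln (real h)" "0 < ln (real h)" using h by auto
  have "ln (real h / 2) \<le> real h / 2 - 1" using h by (intro ln_le_minus_one) auto
  then have "ln (real h) \<le> real h / 2" using h ln_2_less_1 by (simp add: ln_div)
  then have x: "0 < x" "x\<^sup>2 = ln (real h) / real h" "x\<^sup>2 \<le> 1/2"
    using h ln_h by (auto simp: x_def field_simps)
  have "x * \<bar>surplus (parcs T) \<sigma>\<bar> \<le> ln 2 + real h * ln (real h) + real h * (real h - 1) / 2 * x\<^sup>2"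
    using label_surplus_le[OF non_transitive forcing _ _ \<sigma>'(2), where x = x] x h by (simp add: h_def)
  also have "\<dots> = ln 2 + real h * ln (real h) + (real h - 1) / 2 * ln (real h)"
    using h by (simp add: x(2))
  also have "\<dots> \<le> 2 * (real h * ln (real h))"
  proof -
    have "(real h - 1) / 2 * ln (real h) = real h * ln (real h) / 2 - ln (real h) / 2"
      by (simp add: field_simps)
    then show ?thesis using ln_h mult_right_mono[OF h less_imp_le[OF ln_h(2)]] by linarith
  qed
  also have "real h * ln (real h) = x * (real h powr (3/2) * sqrt (ln (real h)))"
  proof -
    have "real h powr (3/2) = real h * sqrt (real h)"
      using h powr_add[of "real h" 1 "1/2"] by (simp add: powr_half_sqrt)
    then show ?thesis using h ln_h by (simp add: x_def real_sqrt_divide)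
  qed
  finally have "\<bar>surplus (parcs T) \<sigma>\<bar> \<le> 2 * (real h powr (3/2) * sqrt (ln (real h)))"
    using x(1) by simp
  then show ?thesis
    unfolding surplus_eq_forward_arcs[OF \<sigma>'(1)] h_def by (simp add: abs_le_iff)
qed

lemma arcs_between_add_swap:
  assumes "U \<subseteq> pverts T" "W \<subseteq> pverts T" "U \<inter> W = {}"
  shows "arcs_between T U W + arcs_between T W U = card U * card W"
proof -
  define A B where "A = {(u, w) \<in> parcs T. u \<in> U \<and> w \<in> W}" and "B = {(w, u) \<in> parcs T. w \<in> W \<and> u \<in> U}"
  have fin: "finite A" "finite B" by (auto simp: A_def B_def intro: finite_subset[OF _ finite_E])
  have "U \<times> W = A \<union> prod.swap ` B"
  proof (intro equalityI subsetI)
    fix e assume "e \<in> U \<times> W"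
    then obtain u w where e: "e = (u, w)" "u \<in> U" "w \<in> W" by auto
    then have "(u, w) \<in> parcs T \<or> (w, u) \<in> parcs T" using exactly_one_arc[of u w] assms by blast
    then show "e \<in> A \<union> prod.swap ` B" using e by (auto simp: A_def B_def image_iff)
  qed (auto simp: A_def B_def)
  moreover have "A \<inter> prod.swap ` B = {}" by (auto simp: A_def B_def dest: arcD)
  ultimately have "card (U \<times> W) = card A + card (prod.swap ` B)" using fin by (simp add: card_Un_disjoint)
  also have "card (prod.swap ` B) = card B" by (simp add: card_image)
  finally show ?thesis by (simp add: arcs_between_def A_def B_def card_cartesian_product)
qed

lemma arcs_between_le:
  assumes non_transitive: "\<not> transitive_tournament T" and forcing: "locally_forcing T"
    and UW: "U \<subseteq> pverts T" "W \<subseteq> pverts T" "U \<inter> W = {}"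
  defines "h \<equiv> card (pverts T)"
  shows "real (arcs_between T U W) \<le> 1/2 * real (card U) * real (card W) + 2 * real h powr (3/2)"
proof -
  have h: "2 \<le> real h" using two_le_card_if_not_transitive[OF non_transitive] by (simp add: h_def)
  \<comment> \<open>the remaining vertices come before \<open>U\<close> for \<open>r = 0\<close> and after \<open>W\<close> for \<open>r = 3\<close>, and their arcs
    cancel in the sum of the two surpluses\<close>
  define c :: "nat \<Rightarrow> 'a \<Rightarrow> nat" where "c r v = (if v \<in> U then 1 else if v \<in> W then 2 else r)" for r v
  have "surplus (parcs T) (c 0) + surplus (parcs T) (c 3)
      = (\<Sum>(u, v)\<in>parcs T. 2 * (of_bool (u \<in> U \<and> v \<in> W) - of_bool (u \<in> W \<and> v \<in> U)))"
    unfolding surplus_def sum.distrib[symmetric]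
    by (intro sum.cong refl) (use UW(3) in \<open>auto simp: c_def order_sign_def\<close>)
  also have "\<dots> = 2 * (real (arcs_between T U W) - real (arcs_between T W U))"
    by (simp add: case_prod_unfold sum_subtractf sum_distrib_left[symmetric] arcs_between_def Int_def)
  also have "\<dots> = 4 * real (arcs_between T U W) - 2 * (real (card U) * real (card W))"
    using arcs_between_add_swap[OF UW] by (simp flip: of_nat_mult)
  finally have surplus: "4 * real (arcs_between T U W) - 2 * (real (card U) * real (card W))
     = surplus (parcs T) (c 0) + surplus (parcs T) (c 3)" ..
  define x where "x = 1 / sqrt (real h)"
  have x: "0 < x" "x\<^sup>2 = 1 / real h" "x\<^sup>2 \<le> 1/2" using h by (auto simp: x_def power_divide field_simps)
  have bound: "x * \<bar>surplus (parcs T) (c r)\<bar> \<le> 4 * real h" if "r \<le> 3" for r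
  proof -
    have "x * \<bar>surplus (parcs T) (c r)\<bar> \<le> ln 2 + real h * ln 4 + real h * (real h - 1) / 2 * x\<^sup>2"
      using label_surplus_le[OF non_transitive forcing, where K = "{0..3}" and c = "c r" and x = x] x that by (auto simp: h_def c_def)
    also have "\<dots> = ln 2 + 2 * (real h * ln 2) + (real h - 1) / 2"
      using h ln_realpow[of 2 2] by (simp add: x(2))
    also have "\<dots> \<le> 4 * real h"
    proof -
      have "real h * ln 2 \<le> real h" using ln_2_less_1 by (simp add: mult_left_le)
      then have "2 * (real h * ln 2) \<le> 2 * real h" by simp
      moreover have "ln 2 + (real h - 1) / 2 \<le> 2 * real h" using h ln_2_less_1 by (simp add: field_simps)
      ultimately show ?thesis by linarith
    qed
    finally show ?thesis .
  qed
  have "x * (4 * real (arcs_between T U W) - 2 * (real (card U) * real (card W)))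
      \<le> x * (\<bar>surplus (parcs T) (c 0)\<bar> + \<bar>surplus (parcs T) (c 3)\<bar>)"
    unfolding surplus using x by (intro mult_left_mono) auto
  also have "\<dots> \<le> 8 * real h" using bound[of 0] bound[of 3] by (simp add: distrib_left)
  also have "\<dots> = x * (8 * real h powr (3/2))"
  proof -
    have "real h powr (3/2) = real h * sqrt (real h)"
      using h powr_add[of "real h" 1 "1/2"] by (simp add: powr_half_sqrt)
    then show ?thesis using h by (simp add: x_def)
  qed
  finally show ?thesis using x(1) by simp
qed

end

theorem theorem1p3:
  fixes H :: "'a pair_pre_digraph" and h :: nat
  assumes "tournament H"
    and "card (pverts H) = h"
    and "\<not> transitive_tournament H"
    and "locally_forcing H"
  shows
    "(\<Sum>v\<in>pverts H. (int (out_degree (with_proj H) v) - int (in_degree (with_proj H) v))\<^sup>2)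
        \<le> int h * (int h - 1)
     \<and> (\<forall>\<sigma>. is_ordering \<sigma> H \<longrightarrow>
        \<bar>real (card (forward_arcs \<sigma> H)) - 1/2 * real (h choose 2)\<bar>
          \<le> real h powr (3/2) * sqrt (ln (real h)))
     \<and> (\<forall>U W. U \<subseteq> pverts H \<and> W \<subseteq> pverts H \<and> U \<inter> W = {} \<longrightarrow>
        real (arcs_between H U W) \<le> 1/2 * real (card U) * real (card W) + 2 * real h powr (3/2))"
proof -
  interpret tournament H by fact
  show ?thesis
    using sum_degree_difference_squared_le[OF assms(3,4)] forward_arcs_deviation_le[OF assms(3,4)]
      arcs_between_le[OF assms(3,4)]
    unfolding assms(2) by blast
qed

end
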